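(* Suppose that for each $\hat\rho_e\ge1$ the state $\mu_e^{(\hat\rho_e)}$ is the unique stationary state (translation invariant or not) of the SSM on $\widehat X_e^*$ with density $\hat\rho_e$. Then for each $\hat\rho>1$ the ETIS states of the SSM with density $\hat\rho$ are precisely the states $\mu^{(\hat\rho,\lambda)}:=\gamma_*(\mu_e^{(\hat\rho_e)}\times\lambda)$, with $\lambda$ an ergodic translation invariant probability measure on $S=\{0,1\}^{\mathbb Z}$ of density $\kappa\le\hat\rho-1$ and $\hat\rho_e=\hat\rho-\kappa$.
   Context: SSM (symmetric stack model): the discrete-time Markov process on $\widehat X=\mathbb Z_+^{\mathbb Z}$, $\mathbb Z_+=\{0,1,2,\dots\}$. A stack $\mathbf n(i)$ is short if $\mathbf n(i)\le1$ and tall otherwise. In passing from $\mathbf n_t$ to $\mathbf n_{t+1}$, simultaneously for each bond $\langle k,k+1\rangle$: if both stacks are short no particle crosses the bond; if one is short and one tall, one particle moves from the tall to the short stack; if both are tall, one particle moves across the bond in a direction chosen with probability $1/2$ each (independently for different bonds). $\widehat X^*\subset\widehat X$ is the set of configurations with no two adjacent short stacks, and $\widehat X^*_e\subset\widehat X^*$ is the subset of configurations with every $\mathbf n(i)$ even; both are invariant under the dynamics. $\gamma:\widehat X^*_e\times S\to\widehat X^*$ is $\gamma(\mathbf m,\sigma)=\mathbf m+\sigma$ (site by site), and $\gamma_*$ denotes push-forward of measures. States are Borel probability measures; TIS = translation invariant and stationary; ETIS = extremal among TIS states. A state (translation invariant or not) has density $\hat\rho$ if almost every $\mathbf n$ satisfies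 $\lim_{N}\frac1N\sum_{i=1}^N\mathbf n(i)=\lim_{N}\frac1N\sum_{i=-N}^{-1}\mathbf n(i)=\hat\rho$; similarly for measures on $S$. For $\hat\rho_e\ge1$, $\mu_e^{(\hat\rho_e)}$ is the state on $\widehat X_e^*$ defined, with $\zeta=(\hat\rho_e-1)/\hat\rho_e\in[0,1)$, as the weak limit (convergence of probabilities of events depending on finitely many sites) as $L\to\infty$ of the measures $\mu^{(\zeta,L)}$ on a ring of $2L+1$ sites indexed by $\{-L,\dots,L\}$, where $\mu^{(\zeta,L)}$ is supported on those $\mathbf n\in\mathbb Z_+^{\{-L,\dots,L\}}$ with all $\mathbf n(i)$ even and no two (cyclically) adjacent zeros, with $\mu^{(\zeta,L)}(\mathbf n)$ proportional to $\zeta^{\sum_i\mathbf n(i)-2L-2}\,4^{-|\{i:\mathbf n(i)=0\}|}$ (convention $0^0=1$). This limit exists and is a translation invariant stationary state of the SSM on $\widehat X^*_e$ of density $\hat\rho_e$. *)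

theory Defs
  imports "HOL-Probability.Probability"
begin

type_synonym config = "int \<Rightarrow> nat"

definition short :: "nat \<Rightarrow> bool" where
  "short h \<longleftrightarrow> h \<le> 1"

(* Signed number of particles crossing the bond between k and k + 1, counted positive from
   left to right. The coin c k is consulted only when both stacks are tall. *)
definition flux :: "config \<Rightarrow> (int \<Rightarrow> bool) \<Rightarrow> int \<Rightarrow> int" where
  "flux n c k =
     (if short (n k) \<and> short (n (k + 1)) then 0
      else if short (n k) then - 1
      else if short (n (k + 1)) then 1
      else if c k then 1 else - 1)"

(* The argument of nat is never negative: only tall stacks lose particles, at most two. *)
definition ssm_step :: "config \<Rightarrow> (int \<Rightarrow> bool) \<Rightarrow> config" where
  "ssm_step n c = (\<lambda>k. nat (int (n k) + flux n c (k - 1) - flux n c k))"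

definition coins :: "(int \<Rightarrow> bool) measure" where
  "coins = (\<Pi>\<^sub>M k\<in>UNIV. measure_pmf (bernoulli_pmf (1/2)))"

definition ssm_evolve :: "config measure \<Rightarrow> config measure" where
  "ssm_evolve M = distr (M \<Otimes>\<^sub>M coins) borel (\<lambda>(n, c). ssm_step n c)"

(* borel is taken for the product topology of the discrete spaces nat. *)
definition state :: "config measure \<Rightarrow> bool" where
  "state M \<longleftrightarrow> prob_space M \<and> sets M = sets borel"

definition state_on :: "config set \<Rightarrow> config measure \<Rightarrow> bool" where
  "state_on A M \<longleftrightarrow> state M \<and> (AE n in M. n \<in> A)"

definition stationary :: "config measure \<Rightarrow> bool" where
  "stationary M \<longleftrightarrow> ssm_evolve M = M"

definition translate :: "int \<Rightarrow> config \<Rightarrow> config" where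
  "translate k n = (\<lambda>i. n (i + k))"

definition translation_invariant :: "config measure \<Rightarrow> bool" where
  "translation_invariant M \<longleftrightarrow> (\<forall>k. distr M borel (translate k) = M)"

definition ergodic :: "config measure \<Rightarrow> bool" where
  "ergodic M \<longleftrightarrow>
     (\<forall>A\<in>sets borel. (\<forall>k. translate k -` A = A) \<longrightarrow> measure M A = 0 \<or> measure M A = 1)"

definition TIS :: "config measure \<Rightarrow> bool" where
  "TIS M \<longleftrightarrow> state M \<and> translation_invariant M \<and> stationary M"

definition ETIS :: "config measure \<Rightarrow> bool" where
  "ETIS M \<longleftrightarrow> TIS M \<and>
     (\<forall>M1 M2 t. TIS M1 \<and> TIS M2 \<and> 0 < t \<and> t < 1 \<and>
        (\<forall>A\<in>sets borel. measure M A = t * measure M1 A + (1 - t) * measure M2 A)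
        \<longrightarrow> M1 = M \<and> M2 = M)"

definition has_density :: "config measure \<Rightarrow> real \<Rightarrow> bool" where
  "has_density M \<rho> \<longleftrightarrow>
     (AE n in M.
        (\<lambda>N::nat. (\<Sum>i\<in>{1..int N}. real (n i)) / real N) \<longlonglongrightarrow> \<rho> \<and>
        (\<lambda>N::nat. (\<Sum>i\<in>{- int N..-1}. real (n i)) / real N) \<longlonglongrightarrow> \<rho>)"

definition Xstar :: "config set" where
  "Xstar = {n. \<forall>i. \<not> (short (n i) \<and> short (n (i + 1)))}"

definition Xstar_even :: "config set" where
  "Xstar_even = {n \<in> Xstar. \<forall>i. even (n i)}"

(* The space S of 0-1 sequences is kept as a subset of the configurations, so that measures on S
   are states concentrated on S and share their notions of invariance and density. *)
definition S :: "config set" where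
  "S = {\<sigma>. \<forall>i. \<sigma> i \<in> {0, 1}}"

definition \<gamma> :: "config \<Rightarrow> config \<Rightarrow> config" where
  "\<gamma> m \<sigma> = (\<lambda>i. m i + \<sigma> i)"

definition \<gamma>_push :: "config measure \<Rightarrow> config measure \<Rightarrow> config measure" where
  "\<gamma>_push M \<Lambda> = distr (M \<Otimes>\<^sub>M \<Lambda>) borel (\<lambda>(m, \<sigma>). \<gamma> m \<sigma>)"

definition ring_succ :: "nat \<Rightarrow> int \<Rightarrow> int" where
  "ring_succ L i = (if i = int L then - int L else i + 1)"

definition ring_configs :: "nat \<Rightarrow> config set" where
  "ring_configs L =
     {n \<in> {- int L..int L} \<rightarrow>\<^sub>E {h. even h}.
        \<forall>i\<in>{- int L..int L}. \<not> (n i = 0 \<and> n (ring_succ L i) = 0)}"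

(* The subtraction does not truncate on ring_configs L: at most L of the 2 L + 1 sites are
   empty, the others carry at least 2 particles. *)
definition ring_weight :: "real \<Rightarrow> nat \<Rightarrow> config \<Rightarrow> real" where
  "ring_weight \<zeta> L n =
     \<zeta> ^ ((\<Sum>i\<in>{- int L..int L}. n i) - (2 * L + 2))
       * (1/4) ^ card {i \<in> {- int L..int L}. n i = 0}"

definition ring_measure :: "real \<Rightarrow> nat \<Rightarrow> config measure" where
  "ring_measure \<zeta> L =
     point_measure (ring_configs L)
       (\<lambda>n. ennreal (ring_weight \<zeta> L n / infsum (ring_weight \<zeta> L) (ring_configs L)))"

definition local_event :: "config set \<Rightarrow> bool" where
  "local_event A \<longleftrightarrow>
     (\<exists>J. finite J \<and> (\<forall>n n'. (\<forall>i\<in>J. n i = n' i) \<longrightarrow> (n \<in> A \<longleftrightarrow> n' \<in> A)))"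

(* Elements of ring_configs L are undefined off {-L..L}; this does not affect the limit, since the
   sites on which a local event depends lie in {-L..L} for large L. *)
definition \<mu>e :: "real \<Rightarrow> config measure" where
  "\<mu>e \<rho> =
     (THE M. state M \<and>
        (\<forall>A. local_event A \<longrightarrow>
           (\<lambda>L. measure (ring_measure ((\<rho> - 1) / \<rho>) L) (A \<inter> ring_configs L))
             \<longlonglongrightarrow> measure M A))"

end

(* Bonds between two short stacks are frozen, and a maximal run of short stacks never splits or is
   born, so the zeros lying in runs of at least two short stacks can only disappear. In a TIS state
   none disappears, which forces such a zero at the left end of a run to travel left at unit speed
   for every choice of coins; this is possible only when the stacks to its left have average height
   at most 1. Hence density greater than 1 leaves only states on Xstar.

   On Xstar exactly one particle crosses every bond, so parities are conserved, and the even part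
   evolves by the same dynamics. Conditioned on any event of the parities, the even part is thus a
   stationary state of known density, and the uniqueness hypothesis makes it independent of the
   parities. So a TIS state is determined by its parity marginal, and it is extremal exactly when
   that marginal is ergodic. *)

theory Submission
  imports Defs
begin

section \<open>Measurability and symmetries of the dynamics\<close>

text \<open>Every finite pattern of coins has positive probability. A statement about the present
  configuration that follows almost surely under one convenient pattern therefore holds almost
  surely, while stationarity supplies almost sure statements about the next configuration. In this
  way bounds travel backwards in time. As a left end advances, the surplus over height one between
  it and a fixed site changes only by particles crossing at the fixed site, and the coins there are
  chosen to point inwards. The obstacle is a short stack followed by a tall one at that place, where
  the direction is forced outwards. This is harmful only if the short stack is a zero ending a run,
  so opposite ends facing each other have to be excluded beforehand. A parity event is in general
  not translation invariant, and neither is the state conditioned on it. The uniqueness hypothesis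
  is therefore applied to states that are merely stationary with a known density.\<close>

lemma measurable_site [measurable]: "(\<lambda>n::config. n k) \<in> borel \<rightarrow>\<^sub>M count_space UNIV"
  using measurable_product_coordinates[of k, where ?'b = nat]
  by (simp add: measurable_cong_sets[OF refl sets_borel_eq_count_space])

lemma measurable_config:
  assumes "\<And>k. (\<lambda>x. f x k) \<in> M \<rightarrow>\<^sub>M count_space UNIV"
  shows "f \<in> M \<rightarrow>\<^sub>M (borel :: config measure)"
proof (rule measurable_coordinatewise_then_product)
  show "(\<lambda>x. f x i) \<in> borel_measurable M" for i
    using assms[of i] by (simp add: measurable_cong_sets[OF refl sets_borel_eq_count_space])
qed

lemma sets_coins: "sets coins = sets (\<Pi>\<^sub>M k\<in>(UNIV :: int set). (count_space UNIV :: bool measure))"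
  unfolding coins_def by (intro sets_PiM_cong) auto

lemma space_coins [simp]: "space coins = UNIV"
  by (simp add: coins_def space_PiM)

lemma measurable_coin [measurable]: "(\<lambda>c. c k) \<in> coins \<rightarrow>\<^sub>M count_space UNIV"
  unfolding measurable_cong_sets[OF sets_coins refl] by (rule measurable_component_singleton) simp

lemma measurable_coins:
  assumes "\<And>k. (\<lambda>x. f x k) \<in> M \<rightarrow>\<^sub>M count_space UNIV"
  shows "f \<in> M \<rightarrow>\<^sub>M coins"
  unfolding measurable_cong_sets[OF refl sets_coins]
  by (rule measurable_PiM_single') (use assms in auto)

lemma fair_coins: "product_prob_space (\<lambda>k::int. measure_pmf (bernoulli_pmf (1/2)))"
  by (rule product_prob_spaceI) (rule prob_space_measure_pmf)

lemma prob_space_coins: "prob_space coins"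
  unfolding coins_def by (rule prob_space_PiM) (rule prob_space_measure_pmf)

lemma measurable_short [measurable]:
  assumes "f \<in> M \<rightarrow>\<^sub>M count_space UNIV"
  shows "Measurable.pred M (\<lambda>x. short (f x))"
  using measurable_compose[OF assms, of short "count_space UNIV"] by simp

lemma measurable_flux: "(\<lambda>x. flux (fst x) (snd x) k) \<in> borel \<Otimes>\<^sub>M coins \<rightarrow>\<^sub>M count_space UNIV"
proof -
  have [measurable]: "Measurable.pred (borel \<Otimes>\<^sub>M coins) (\<lambda>x. short (fst x i))" for i :: int
    by (rule measurable_short[OF measurable_compose[OF measurable_fst measurable_site]])
  have [measurable]: "Measurable.pred (borel \<Otimes>\<^sub>M coins) (\<lambda>x. snd x i)" for i
    by (rule measurable_compose[OF measurable_snd measurable_coin])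
  show ?thesis
    unfolding flux_def by measurable
qed

lemma measurable_ssm_step [measurable]:
  "(\<lambda>(n, c). ssm_step n c) \<in> borel \<Otimes>\<^sub>M coins \<rightarrow>\<^sub>M borel"
proof (rule measurable_config)
  fix k
  let ?g = "\<lambda>x::config \<times> (int \<Rightarrow> bool). (fst x k, flux (fst x) (snd x) (k - 1), flux (fst x) (snd x) k)"
  have "?g \<in> borel \<Otimes>\<^sub>M coins \<rightarrow>\<^sub>M count_space UNIV \<Otimes>\<^sub>M (count_space UNIV \<Otimes>\<^sub>M count_space UNIV)"
    by (intro measurable_Pair measurable_flux measurable_compose[OF measurable_fst measurable_site])
  \<comment> \<open>The triple ranges over a countable set, so every function of it is measurable
    and the formula for the new height needs no further analysis.\<close>
  then have "?g \<in> borel \<Otimes>\<^sub>M coins \<rightarrow>\<^sub>M count_space UNIV"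
    by (simp add: pair_measure_countable)
  from measurable_compose[OF this, of "\<lambda>(h, a, b). nat (int h + a - b)" "count_space UNIV"]
  show "(\<lambda>x. (case x of (n, c) \<Rightarrow> ssm_step n c) k) \<in> borel \<Otimes>\<^sub>M coins \<rightarrow>\<^sub>M count_space UNIV"
    by (simp add: ssm_step_def case_prod_beta)
qed

lemma measurable_translate [measurable]: "translate k \<in> borel \<rightarrow>\<^sub>M borel"
  unfolding translate_def by (rule measurable_config) measurable

lemma measurable_\<gamma> [measurable]: "(\<lambda>(m, \<sigma>). \<gamma> m \<sigma>) \<in> borel \<Otimes>\<^sub>M borel \<rightarrow>\<^sub>M borel"
  unfolding \<gamma>_def case_prod_beta by (rule measurable_config) measurable

section \<open>Symmetries of the coins and their finite patterns\<close>

lemma fair_coin_flip: "map_pmf (\<lambda>x. x \<noteq> b) (bernoulli_pmf (1/2)) = bernoulli_pmf (1/2)"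
proof (rule pmf_eqI)
  have h: "pmf (bernoulli_pmf (1/2)) x = 1/2" for x
    by (cases x) simp_all
  have "inj (\<lambda>x. x \<noteq> b)"
    by (auto simp: inj_on_def)
  from pmf_map_inj'[OF this, of "bernoulli_pmf (1/2)" "i \<noteq> b" for i]
  have "pmf (map_pmf (\<lambda>x. x \<noteq> b) (bernoulli_pmf (1/2))) ((i \<noteq> b) \<noteq> b) = 1/2" for i
    unfolding h by blast
  moreover have "((i \<noteq> b) \<noteq> b) = i" for i
    by blast
  ultimately show "pmf (map_pmf (\<lambda>x. x \<noteq> b) (bernoulli_pmf (1/2))) i = pmf (bernoulli_pmf (1/2)) i" for i
    unfolding h by (simp only:)
qed

text \<open>An injection on bonds keeps the coins independent, and a fair coin stays fair when
  turned over. With \<open>b\<close> false this serves translations; with \<open>b\<close> true it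
  serves the reflection, which reverses the direction of every bond.\<close>

lemma coins_symmetric:
  assumes "inj \<pi>"
  shows "distr coins coins (\<lambda>c k. c (\<pi> k) \<noteq> b) = coins"
proof -
  have m: "(\<lambda>c k. c (\<pi> k) \<noteq> b) \<in> coins \<rightarrow>\<^sub>M coins"
    by (rule measurable_coins) measurable
  let ?p = "\<lambda>k::int. measure_pmf (bernoulli_pmf (1/2))"
  have "distr coins coins (\<lambda>c k. c (\<pi> k) \<noteq> b) = (\<Pi>\<^sub>M k\<in>UNIV. ?p k)"
  proof (rule product_prob_space.PiM_eq[OF fair_coins])
    show "sets (distr coins coins (\<lambda>c k. c (\<pi> k) \<noteq> b)) = sets (Pi\<^sub>M UNIV ?p)"
      by (simp add: coins_def)
    fix J :: "int set" and F :: "int \<Rightarrow> bool set"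
    assume J: "finite J"
    have e: "prod_emb UNIV ?p J (Pi\<^sub>E J F) = {c. \<forall>j\<in>J. c j \<in> F j}"
      by (auto simp: prod_emb_def space_PiM)
    have s: "prod_emb UNIV ?p J (Pi\<^sub>E J F) \<in> sets coins"
      unfolding coins_def by (rule sets_PiM_I) (use J in auto)
    have "emeasure (distr coins coins (\<lambda>c k. c (\<pi> k) \<noteq> b)) (prod_emb UNIV ?p J (Pi\<^sub>E J F))
      = emeasure coins {c. \<forall>j\<in>J. (c (\<pi> j) \<noteq> b) \<in> F j}"
      using s by (subst emeasure_distr[OF m]) (auto simp: e vimage_def)
    also have "{c. \<forall>j\<in>J. (c (\<pi> j) \<noteq> b) \<in> F j} =
      {c \<in> space (Pi\<^sub>M UNIV ?p). \<forall>i\<in>\<pi> ` J. c i \<in> {x. (x \<noteq> b) \<in> F (inv \<pi> i)}}"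
      using assms by (auto simp: space_PiM)
    also have "emeasure coins \<dots> =
      (\<Prod>i\<in>\<pi> ` J. emeasure (?p i) {x. (x \<noteq> b) \<in> F (inv \<pi> i)})"
      unfolding coins_def by (rule product_prob_space.emeasure_PiM_Collect[OF fair_coins]) (use J in auto)
    also have "\<dots> = (\<Prod>j\<in>J. emeasure (?p j) {x. (x \<noteq> b) \<in> F j})"
      using assms by (subst prod.reindex) (auto simp: inj_on_def)
    also have "\<dots> = (\<Prod>j\<in>J. emeasure (map_pmf (\<lambda>x. x \<noteq> b) (bernoulli_pmf (1/2))) (F j))"
      by (simp add: emeasure_map_pmf vimage_def)
    also have "\<dots> = (\<Prod>j\<in>J. emeasure (?p j) (F j))"
      by (simp only: fair_coin_flip)
    finally show "emeasure (distr coins coins (\<lambda>c k. c (\<pi> k) \<noteq> b)) (prod_emb UNIV ?p J (Pi\<^sub>E J F))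
      = (\<Prod>j\<in>J. emeasure (?p j) (F j))" .
  qed
  then show ?thesis
    by (simp add: coins_def)
qed

lemma not_AE_coins:
  assumes "finite J"
  shows "\<not> (AE c in coins. \<not> (\<forall>j\<in>J. c j = p j))"
proof
  assume *: "AE c in coins. \<not> (\<forall>j\<in>J. c j = p j)"
  have "emeasure coins {c \<in> space coins. \<forall>j\<in>J. c j = p j} = 0"
    by (rule emeasure_eq_0_AE) (use * in auto)
  moreover have "emeasure coins {c \<in> space coins. \<forall>j\<in>J. c j = p j} =
      (\<Prod>j\<in>J. emeasure (bernoulli_pmf (1/2)) {p j})"
    using product_prob_space.emeasure_PiM_Collect[OF fair_coins, of J UNIV "\<lambda>j. {p j}"] assms by (simp add: coins_def)
  ultimately have "(\<Prod>j\<in>J. emeasure (bernoulli_pmf (1/2)) {p j}) = 0"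
    by argo
  moreover have "emeasure (bernoulli_pmf (1/2)) {p j} = ennreal (1/2)" for j
    unfolding emeasure_pmf_single by (cases "p j") simp_all
  ultimately have "ennreal ((1/2) ^ card J) = 0"
    by (simp only: prod_constant ennreal_power divide_nonneg_nonneg zero_le_one zero_le_numeral)
  moreover have "0 < (1/2::real) ^ card J"
    by simp
  ultimately show False
    unfolding ennreal_eq_0_iff by linarith
qed

section \<open>Almost sure statements under steps and translations\<close>

lemma stateD:
  assumes "state M"
  shows "prob_space M" "sets M = sets borel" "space M = UNIV"
  using assms sets_eq_imp_space_eq[of M borel] by (auto simp: state_def)

lemma measurable_step_state:
  assumes "sets M = sets borel"
  shows "(\<lambda>(n, c). ssm_step n c) \<in> M \<Otimes>\<^sub>M coins \<rightarrow>\<^sub>M borel"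
  using measurable_ssm_step assms
  by (simp add: measurable_cong_sets[OF sets_pair_measure_cong[OF assms refl] refl])

lemma state_distr:
  assumes "prob_space M" "f \<in> M \<rightarrow>\<^sub>M borel"
  shows "state (distr M borel f)"
  using prob_space.prob_space_distr[OF assms] by (simp add: state_def)

lemma AE_pair_coins:
  assumes "prob_space M" "AE x in M \<Otimes>\<^sub>M coins. Q x"
  shows "AE n in M. AE c in coins. Q (n, c)"
proof -
  interpret M: prob_space M by fact
  interpret coins: prob_space coins by (rule prob_space_coins)
  interpret pair_sigma_finite M coins ..
  show ?thesis
    using AE_pair[OF assms(2)] .
qed

lemma AE_fst:
  assumes "prob_space N" "AE n in M. Q n"
  shows "AE x in M \<Otimes>\<^sub>M N. Q (fst x)"
proof -
  have "AE n in distr (M \<Otimes>\<^sub>M N) M fst. Q n"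
    using assms(2) prob_space.distr_pair_fst[OF assms(1)] by metis
  then show ?thesis
    by (rule AE_distrD[rotated]) simp
qed

lemma stationary_AE:
  assumes "state M" "stationary M" "AE n in M. Q n"
  shows "AE n in M. AE c in coins. Q (ssm_step n c)"
proof -
  have "AE n in distr (M \<Otimes>\<^sub>M coins) borel (\<lambda>(n, c). ssm_step n c). Q n"
    using assms(2,3) unfolding stationary_def ssm_evolve_def by metis
  then have "AE x in M \<Otimes>\<^sub>M coins. Q ((\<lambda>(n, c). ssm_step n c) x)"
    by (rule AE_distrD[rotated]) (rule measurable_step_state[OF stateD(2)[OF assms(1)]])
  from AE_pair_coins[OF stateD(1)[OF assms(1)] this] show ?thesis
    by simp
qed

text \<open>A finite pattern has positive probability, so an almost sure implication from it is not
  vacuous, and its conclusion \<open>Q\<close> does not mention the coins. This allows a step to be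
  examined under the most convenient coins.\<close>

lemma AE_coins_pattern:
  assumes "AE c in coins. (\<forall>j\<in>J. c j = p j) \<longrightarrow> Q" "finite J"
  shows Q
proof (rule ccontr)
  assume "\<not> Q"
  then have "AE c in coins. \<not> (\<forall>j\<in>J. c j = p j)"
    using assms(1) by simp
  then show False
    using not_AE_coins[OF assms(2)] by blast
qed

lemma translate_AE:
  assumes "state M" "translation_invariant M" "AE n in M. Q n"
  shows "AE n in M. Q (translate k n)"
proof -
  have "AE n in distr M borel (translate k). Q n"
    using assms(2,3) unfolding translation_invariant_def by metis
  then show ?thesis
    by (rule AE_distrD[rotated]) (simp add: measurable_cong_sets[OF stateD(2)[OF assms(1)] refl])
qed

lemma translate_AE_all:
  fixes Q :: "int \<Rightarrow> config \<Rightarrow> bool"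
  assumes "state M" "translation_invariant M" "AE n in M. Q 0 n"
    and "\<And>k n. Q 0 (translate k n) = Q k n"
  shows "AE n in M. \<forall>k. Q k n"
  using translate_AE[OF assms(1-3)] by (simp add: AE_all_countable assms(4))

section \<open>Maps that commute with the dynamics\<close>

lemma flux_translate: "flux (translate k n) (\<lambda>i. c (i + k)) i = flux n c (i + k)"
  by (simp add: flux_def translate_def algebra_simps)

lemma step_translate:
  "ssm_step (translate k n) (\<lambda>i. c (i + k)) = translate k (ssm_step n c)"
proof
  show "ssm_step (translate k n) (\<lambda>i. c (i + k)) i = translate k (ssm_step n c) i" for i
    by (simp only: ssm_step_def flux_translate) (simp add: translate_def algebra_simps)
qed

lemma distr_pair_coins:
  assumes M: "state M" and T: "T \<in> borel \<rightarrow>\<^sub>M borel" and U: "U \<in> coins \<rightarrow>\<^sub>M coins"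
    and "distr coins coins U = coins"
  shows "distr M borel T \<Otimes>\<^sub>M coins = distr (M \<Otimes>\<^sub>M coins) (borel \<Otimes>\<^sub>M coins) (\<lambda>(n, c). (T n, U c))"
proof -
  have "distr M borel T \<Otimes>\<^sub>M distr coins coins U =
      distr (M \<Otimes>\<^sub>M coins) (borel \<Otimes>\<^sub>M coins) (\<lambda>(n, c). (T n, U c))"
    using assms prob_space_coins prob_space_imp_sigma_finite
    by (intro pair_measure_distr) (auto simp: measurable_cong_sets[OF stateD(2)[OF M] refl])
  then show ?thesis
    using assms(4) by simp
qed

text \<open>Transport along a map that intertwines the dynamics, after a change \<open>U\<close> of
  coins that keeps their law. The intertwining is asked only almost surely because passing to even
  parts is guaranteed to commute with a step only on \<open>Xstar\<close>.\<close>

lemma stationary_distr: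
  assumes M: "state M" "stationary M"
    and T [measurable]: "T \<in> borel \<rightarrow>\<^sub>M borel" and U [measurable]: "U \<in> coins \<rightarrow>\<^sub>M coins"
    and inv: "distr coins coins U = coins"
    and comm: "AE n in M. \<forall>c. ssm_step (T n) (U c) = T (ssm_step n c)"
  shows "stationary (distr M borel T)"
proof -
  note [measurable_cong] = stateD(2)[OF M(1)]
  let ?s = "\<lambda>(n, c). ssm_step n c"
  have "ssm_evolve (distr M borel T) = distr (M \<Otimes>\<^sub>M coins) borel (\<lambda>x. ?s ((\<lambda>(n, c). (T n, U c)) x))"
    unfolding ssm_evolve_def distr_pair_coins[OF M(1) T U inv] by (subst distr_distr) (auto simp: comp_def)
  also have "\<dots> = distr (M \<Otimes>\<^sub>M coins) borel (\<lambda>x. T (?s x))"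
  proof (rule distr_cong_AE)
    show "AE x in M \<Otimes>\<^sub>M coins. ?s ((\<lambda>(n, c). (T n, U c)) x) = T (?s x)"
      using AE_fst[OF prob_space_coins comm] by (auto elim!: eventually_mono)
  qed (auto simp: case_prod_beta)
  also have "\<dots> = distr (ssm_evolve M) borel T"
    unfolding ssm_evolve_def by (subst distr_distr) (auto simp: comp_def)
  also have "\<dots> = distr M borel T"
    using M(2) by (simp add: stationary_def)
  finally show ?thesis
    by (simp add: stationary_def)
qed

lemma coins_shift:
  "(\<lambda>c k. c (k + j)) \<in> coins \<rightarrow>\<^sub>M coins" "distr coins coins (\<lambda>c k. c (k + j)) = coins"
proof -
  show "(\<lambda>c k. c (k + j)) \<in> coins \<rightarrow>\<^sub>M coins"
    by (rule measurable_coins) measurable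
  show "distr coins coins (\<lambda>c k. c (k + j)) = coins"
    using coins_symmetric[of "\<lambda>k. k + j" False] by (simp add: inj_on_def)
qed

lemma stationary_translate:
  assumes "state M" "stationary M"
  shows "stationary (distr M borel (translate k))"
  by (rule stationary_distr[OF assms _ coins_shift[of k]]) (auto simp: step_translate)

text \<open>Events about a single step, such as the motion of a zero, involve configuration and
  coins, so both are shifted together.\<close>

lemma joint_translate:
  assumes M: "state M" "translation_invariant M"
    and Q: "Measurable.pred (borel \<Otimes>\<^sub>M coins) (\<lambda>(n, c). Q n c)"
  shows "measure (M \<Otimes>\<^sub>M coins) {(n, c). Q (translate k n) (\<lambda>i. c (i + k))} =
    measure (M \<Otimes>\<^sub>M coins) {(n, c). Q n c}"
proof -
  let ?f = "\<lambda>(n, c). (translate k n, (\<lambda>i. c (i + k)) :: int \<Rightarrow> bool)"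
  have "M \<Otimes>\<^sub>M coins = distr (M \<Otimes>\<^sub>M coins) (borel \<Otimes>\<^sub>M coins) ?f"
    using distr_pair_coins[OF M(1) measurable_translate coins_shift] M(2)
    by (simp add: translation_invariant_def)
  moreover have "measure (distr (M \<Otimes>\<^sub>M coins) (borel \<Otimes>\<^sub>M coins) ?f) {(n, c). Q n c} =
    measure (M \<Otimes>\<^sub>M coins) (?f -` {(n, c). Q n c} \<inter> space (M \<Otimes>\<^sub>M coins))"
  proof (rule measure_distr)
    note [measurable] = coins_shift(1)[of k] and [measurable_cong] = stateD(2)[OF M(1)]
    show "?f \<in> M \<Otimes>\<^sub>M coins \<rightarrow>\<^sub>M borel \<Otimes>\<^sub>M coins"
      by measurable
    show "{(n, c). Q n c} \<in> sets (borel \<Otimes>\<^sub>M coins)"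
      using Q by (simp add: pred_def space_pair_measure case_prod_unfold)
  qed
  moreover have "?f -` {(n, c). Q n c} \<inter> space (M \<Otimes>\<^sub>M coins) =
      {(n, c). Q (translate k n) (\<lambda>i. c (i + k))}"
    by (auto simp: space_pair_measure stateD(3)[OF M(1)])
  ultimately show ?thesis
    by metis
qed

lemma measure_step:
  assumes M: "state M" "stationary M" and Q: "Measurable.pred borel Q"
  shows "measure (M \<Otimes>\<^sub>M coins) {(n, c). Q (ssm_step n c)} = measure M {n. Q n}"
proof -
  have "measure M {n. Q n} = measure (distr (M \<Otimes>\<^sub>M coins) borel (\<lambda>(n, c). ssm_step n c)) {n. Q n}"
    using M(2) by (simp add: stationary_def ssm_evolve_def)
  also have "\<dots> = measure (M \<Otimes>\<^sub>M coins) ((\<lambda>(n, c). ssm_step n c) -` {n. Q n} \<inter> space (M \<Otimes>\<^sub>M coins))"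
    using Q by (intro measure_distr measurable_step_state stateD(2)[OF M(1)]) (simp add: pred_def)
  also have "(\<lambda>(n, c). ssm_step n c) -` {n. Q n} \<inter> space (M \<Otimes>\<^sub>M coins) = {(n, c). Q (ssm_step n c)}"
    by (auto simp: space_pair_measure stateD(3)[OF M(1)])
  finally show ?thesis ..
qed

lemma measure_joint_fst:
  assumes M: "state M" and Q: "Measurable.pred borel Q"
  shows "measure (M \<Otimes>\<^sub>M coins) {(n, c). Q n} = measure M {n. Q n}"
proof -
  have "measure M {n. Q n} = measure (distr (M \<Otimes>\<^sub>M coins) M fst) {n. Q n}"
    by (simp add: prob_space.distr_pair_fst[OF prob_space_coins])
  also have "\<dots> = measure (M \<Otimes>\<^sub>M coins) (fst -` {n. Q n} \<inter> space (M \<Otimes>\<^sub>M coins))"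
    using Q by (intro measure_distr) (simp_all add: pred_def stateD(2)[OF M])
  also have "fst -` {n. Q n} \<inter> space (M \<Otimes>\<^sub>M coins) = {(n, c). Q n}"
    by (auto simp: space_pair_measure stateD(3)[OF M])
  finally show ?thesis ..
qed

text \<open>Almost surely no step enters or leaves \<open>A\<close>, so restricting the law to
  \<open>A\<close> before the step and restricting it afterwards give the same result.\<close>

lemma stationary_uniform:
  assumes M: "state M" "stationary M" and A: "A \<in> sets borel"
    and inv: "AE n in M. \<forall>c. ssm_step n c \<in> A \<longleftrightarrow> n \<in> A"
  shows "stationary (uniform_measure M A)"
proof -
  note [measurable_cong] = stateD(2)[OF M(1)] and [measurable] = A
  interpret coins: prob_space coins by (rule prob_space_coins)
  let ?s = "\<lambda>(n, c). ssm_step n c"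
  have "emeasure (ssm_evolve (uniform_measure M A)) B = emeasure (uniform_measure M A) B"
    if B [measurable]: "B \<in> sets borel" for B
  proof -
    have sB: "?s -` B \<inter> space (M \<Otimes>\<^sub>M coins) \<in> sets (M \<Otimes>\<^sub>M coins)"
      by (rule measurable_sets[OF measurable_step_state[OF stateD(2)[OF M(1)]] B])
    have sAB: "?s -` (A \<inter> B) \<inter> space (M \<Otimes>\<^sub>M coins) \<in> sets (M \<Otimes>\<^sub>M coins)"
      by (rule measurable_sets[OF measurable_step_state[OF stateD(2)[OF M(1)]]]) measurable
    have "emeasure (ssm_evolve (uniform_measure M A)) B =
      emeasure (uniform_measure M A \<Otimes>\<^sub>M coins) (?s -` B \<inter> space (uniform_measure M A \<Otimes>\<^sub>M coins))"
      unfolding ssm_evolve_def by (rule emeasure_distr) (auto intro!: measurable_step_state stateD M B)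
    also have "?s -` B \<inter> space (uniform_measure M A \<Otimes>\<^sub>M coins) = ?s -` B \<inter> space (M \<Otimes>\<^sub>M coins)"
      by (simp add: space_pair_measure)
    also have "emeasure (uniform_measure M A \<Otimes>\<^sub>M coins) (?s -` B \<inter> space (M \<Otimes>\<^sub>M coins)) =
      (\<integral>\<^sup>+n. emeasure coins (Pair n -` (?s -` B \<inter> space (M \<Otimes>\<^sub>M coins))) \<partial>uniform_measure M A)"
      using sB by (intro coins.emeasure_pair_measure_alt)
        (simp cong: sets_pair_measure_cong)
    also have "\<dots> = (\<integral>\<^sup>+n. emeasure coins (Pair n -` (?s -` B \<inter> space (M \<Otimes>\<^sub>M coins))) * indicator A n \<partial>M)
        / emeasure M A"
      using coins.measurable_emeasure_Pair[OF sB] A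
      by (intro nn_integral_uniform_measure) (auto simp: stateD(2)[OF M(1)])
    also have "(\<integral>\<^sup>+n. emeasure coins (Pair n -` (?s -` B \<inter> space (M \<Otimes>\<^sub>M coins))) * indicator A n \<partial>M) =
      (\<integral>\<^sup>+n. emeasure coins (Pair n -` (?s -` (A \<inter> B) \<inter> space (M \<Otimes>\<^sub>M coins))) \<partial>M)"
    proof (rule nn_integral_cong_AE)
      show "AE n in M. emeasure coins (Pair n -` (?s -` B \<inter> space (M \<Otimes>\<^sub>M coins))) * indicator A n =
          emeasure coins (Pair n -` (?s -` (A \<inter> B) \<inter> space (M \<Otimes>\<^sub>M coins)))"
        using inv
      proof eventually_elim
        case (elim n)
        then have "Pair n -` (?s -` (A \<inter> B) \<inter> space (M \<Otimes>\<^sub>M coins)) =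
            (if n \<in> A then Pair n -` (?s -` B \<inter> space (M \<Otimes>\<^sub>M coins)) else {})"
          by auto
        then show ?case
          by simp
      qed
    qed
    also have "\<dots> = emeasure (M \<Otimes>\<^sub>M coins) (?s -` (A \<inter> B) \<inter> space (M \<Otimes>\<^sub>M coins))"
      by (rule coins.emeasure_pair_measure_alt[symmetric, OF sAB])
    also have "\<dots> = emeasure (ssm_evolve M) (A \<inter> B)"
      unfolding ssm_evolve_def
      by (rule emeasure_distr[symmetric]) (auto intro!: measurable_step_state stateD M A B)
    also have "\<dots> / emeasure M A = emeasure (uniform_measure M A) B"
      using M(2) by (simp add: stationary_def stateD(2)[OF M(1)] A B)
    finally show ?thesis .
  qed
  then show ?thesis
    unfolding stationary_def
    by (intro measure_eqI) (auto simp: ssm_evolve_def stateD(2)[OF M(1)])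
qed

lemma translation_invariant_uniform:
  assumes M: "state M" "translation_invariant M" and A: "A \<in> sets borel"
    and inv: "\<And>k. translate k -` A = A"
  shows "translation_invariant (uniform_measure M A)"
  unfolding translation_invariant_def
proof (intro allI measure_eqI)
  note [measurable_cong] = stateD(2)[OF M(1)]
  fix k B assume "B \<in> sets (distr (uniform_measure M A) borel (translate k))"
  then have B: "B \<in> sets borel" by simp
  have t: "translate k \<in> M \<rightarrow>\<^sub>M borel" by measurable
  have tB: "translate k -` B \<in> sets borel"
    using measurable_sets[OF measurable_translate B, of k] by simp
  have "emeasure (distr (uniform_measure M A) borel (translate k)) B =
    emeasure (uniform_measure M A) (translate k -` B)"
    using B by (subst emeasure_distr) (auto simp: stateD(3)[OF M(1)])
  also have "\<dots> = emeasure M (translate k -` (A \<inter> B)) / emeasure M A"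
    using A tB by (simp add: stateD(2)[OF M(1)] inv vimage_Int)
  also have "emeasure M (translate k -` (A \<inter> B)) = emeasure (distr M borel (translate k)) (A \<inter> B)"
    using A B by (subst emeasure_distr[OF t]) (auto simp: stateD(3)[OF M(1)])
  also have "\<dots> = emeasure M (A \<inter> B)"
    using M(2) by (simp add: translation_invariant_def)
  also have "\<dots> / emeasure M A = emeasure (uniform_measure M A) B"
    using A B by (simp add: stateD(2)[OF M(1)])
  finally show "emeasure (distr (uniform_measure M A) borel (translate k)) B =
    emeasure (uniform_measure M A) B" .
qed (simp add: stateD(2)[OF M(1)])

lemma state_uniform:
  assumes "state M" "emeasure M A \<noteq> 0"
  shows "state (uniform_measure M A)"
proof -
  interpret prob_space M by (rule stateD(1)[OF assms(1)])
  show ?thesis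
    using prob_space_uniform_measure[OF assms(2)] stateD(2)[OF assms(1)] by (simp add: state_def)
qed

section \<open>Runs of short stacks\<close>

lemma step_int: "int (ssm_step n c k) = int (n k) + flux n c (k - 1) - flux n c k"
  by (auto simp: ssm_step_def flux_def short_def)

lemma measurable_fst_site [measurable]:
  "(\<lambda>x. fst x (k :: int)) \<in> borel \<Otimes>\<^sub>M coins \<rightarrow>\<^sub>M (count_space UNIV :: nat measure)"
  by (rule measurable_compose[OF measurable_fst measurable_site])

lemma measurable_step_site [measurable]:
  "(\<lambda>x. ssm_step (fst x) (snd x) k) \<in> borel \<Otimes>\<^sub>M coins \<rightarrow>\<^sub>M count_space UNIV"
  using measurable_compose[OF measurable_ssm_step measurable_site, of k] by (simp add: case_prod_beta)

text \<open>Only runs of at least two short stacks that begin with an empty stack have an end in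
  this sense; a run beginning with height 1 has none.\<close>

definition left_end :: "int \<Rightarrow> config \<Rightarrow> bool" where
  "left_end k n \<longleftrightarrow> \<not> short (n (k - 1)) \<and> n k = 0 \<and> short (n (k + 1))"

definition right_end :: "int \<Rightarrow> config \<Rightarrow> bool" where
  "right_end k n \<longleftrightarrow> short (n (k - 1)) \<and> n k = 0 \<and> \<not> short (n (k + 1))"

definition clustered_zero :: "int \<Rightarrow> config \<Rightarrow> bool" where
  "clustered_zero k n \<longleftrightarrow> n k = 0 \<and> (short (n (k - 1)) \<or> short (n (k + 1)))"

text \<open>The stack of height 2 at \<open>k\<close> can become empty only by losing a particle on
  each side. One of them fills the clustered zero at \<open>k + 1\<close>, so this zero is regarded
  as having moved to \<open>k\<close>.\<close>

definition zero_from_right :: "int \<Rightarrow> config \<Rightarrow> (int \<Rightarrow> bool) \<Rightarrow> bool" where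
  "zero_from_right k n c \<longleftrightarrow> n k = 2 \<and> ssm_step n c k = 0 \<and> n (k + 1) = 0 \<and> short (n (k + 2))"

definition zero_from_left :: "int \<Rightarrow> config \<Rightarrow> (int \<Rightarrow> bool) \<Rightarrow> bool" where
  "zero_from_left k n c \<longleftrightarrow> n k = 2 \<and> ssm_step n c k = 0 \<and> n (k - 1) = 0 \<and> short (n (k - 2))"

text \<open>An empty stack stays empty only between two frozen bonds. A new zero arises from height
  2 by losses on both sides; a neighbour that receives one of these particles and is short
  afterwards must have been empty with its other bond frozen, hence a clustered zero itself.\<close>

lemma clustered_zero_step:
  assumes "clustered_zero k (ssm_step n c)"
  shows "clustered_zero k n \<or> zero_from_right k n c \<or> zero_from_left k n c"
proof -
  have z: "ssm_step n c k = 0"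
    using assms by (simp add: clustered_zero_def)
  show ?thesis
  proof (cases "short (n k)")
    case True
    then show ?thesis
      using z step_int[of n c k] by (auto simp: clustered_zero_def flux_def short_def split: if_splits)
  next
    case False
    then have n2: "n k = 2" and f: "flux n c (k - 1) = - 1" "flux n c k = 1"
      using z step_int[of n c k] by (auto simp: flux_def short_def split: if_splits)
    consider "short (ssm_step n c (k + 1))" | "short (ssm_step n c (k - 1))"
      using assms by (auto simp: clustered_zero_def)
    then show ?thesis
    proof cases
      case 1
      then have "n (k + 1) = 0 \<and> short (n (k + 2))"
        using step_int[of n c "k + 1"] f(2)
        by (auto simp: flux_def[of n c "k + 1"] short_def add.assoc split: if_splits)
      then show ?thesis
        using n2 z by (simp add: zero_from_right_def)
    next
      case 2
      then have "n (k - 1) = 0 \<and> short (n (k - 2))"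
        using step_int[of n c "k - 1"] f(1)
        by (auto simp: flux_def[of n c "k - 2"] short_def split: if_splits)
      then show ?thesis
        using n2 z by (simp add: zero_from_left_def)
    qed
  qed
qed

text \<open>Z and Z' stand for a clustered zero at the origin before and after a step, K for a zero that
  stays, and R, L (R', L' at the target site) for a zero that moves; stationarity and translation
  invariance give the equalities.\<close>

lemma (in prob_space) prob_balance:
  assumes [measurable]: "Z \<in> events" "Z' \<in> events" "K \<in> events" "R \<in> events" "R' \<in> events"
      "L \<in> events" "L' \<in> events"
    and sub: "Z' \<subseteq> K \<union> (R' \<union> L')" "K \<union> (R \<union> L) \<subseteq> Z"
    and disj: "K \<inter> (R \<union> L) = {}" "R \<inter> L = {}"
    and eq: "prob Z' = prob Z" "prob R' = prob R" "prob L' = prob L"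
  shows "prob (Z - (K \<union> (R \<union> L))) = 0" "prob (R' \<inter> L') = 0"
proof -
  have "prob Z' \<le> prob (K \<union> (R' \<union> L'))"
    using sub(1) by (intro finite_measure_mono) auto
  also have "\<dots> \<le> prob K + prob (R' \<union> L')"
    by (rule measure_Un_le) auto
  also have "prob (R' \<union> L') = prob R' + prob L' - prob (R' \<inter> L')"
    by (rule measure_Un3) (auto simp: fmeasurable_eq_sets)
  finally have 1: "prob Z \<le> prob K + prob R + prob L - prob (R' \<inter> L')"
    using eq by simp
  have "prob (K \<union> (R \<union> L)) = prob K + (prob R + prob L)"
    using disj by (simp add: finite_measure_Union)
  moreover have "prob (Z - (K \<union> (R \<union> L))) = prob Z - prob (K \<union> (R \<union> L))"
    using sub(2) by (intro finite_measure_Diff) auto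
  ultimately have "prob (Z - (K \<union> (R \<union> L))) + prob (R' \<inter> L') \<le> 0"
    using 1 by simp
  then show "prob (Z - (K \<union> (R \<union> L))) = 0" "prob (R' \<inter> L') = 0"
    using measure_nonneg[of M "Z - (K \<union> (R \<union> L))"] measure_nonneg[of M "R' \<inter> L'"] by linarith+
qed

text \<open>The last clause excludes the merging of two runs, which would destroy a clustered zero.\<close>

definition regular :: "int \<Rightarrow> config \<Rightarrow> bool" where
  "regular k n \<longleftrightarrow>
     (left_end k n \<longrightarrow> n (k - 1) = 2 \<and> short (n (k - 2))) \<and>
     (right_end k n \<longrightarrow> n (k + 1) = 2 \<and> short (n (k + 2))) \<and>
     \<not> (short (n (k - 2)) \<and> n (k - 1) = 0 \<and> n k = 2 \<and> n (k + 1) = 0 \<and> short (n (k + 2)))"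

text \<open>The zero at an end is filled by its tall neighbour, so if it is not lost it has moved
  there, and the neighbour went from 2 to 0. This neighbour also gave a particle across its outer
  bond, where the chosen coin points towards it; so the coin was not consulted and the stack beyond
  is short.\<close>

lemma regularI:
  assumes z: "clustered_zero 0 n \<Longrightarrow>
      (clustered_zero 0 n \<and> ssm_step n c 0 = 0) \<or> zero_from_right (- 1) n c \<or> zero_from_left 1 n c"
    and nm: "\<not> (zero_from_right 0 n c \<and> zero_from_left 0 n c)"
    and c: "c (- 2)" "\<not> c 1"
  shows "regular 0 n"
  unfolding regular_def
proof (intro conjI impI)
  assume l: "left_end 0 n"
  then have "ssm_step n c 0 = 1"
    using step_int[of n c 0] by (auto simp: left_end_def flux_def short_def)
  then have r: "zero_from_right (- 1) n c"
    using l z by (auto simp: left_end_def clustered_zero_def zero_from_left_def short_def)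
  then show "n (0 - 1) = 2"
    by (simp add: zero_from_right_def)
  show "short (n (0 - 2))"
    using r c(1) step_int[of n c "- 1"]
    by (auto simp: zero_from_right_def flux_def short_def split: if_splits)
next
  assume l: "right_end 0 n"
  then have "ssm_step n c 0 = 1"
    using step_int[of n c 0] by (auto simp: right_end_def flux_def short_def)
  then have r: "zero_from_left 1 n c"
    using l z by (auto simp: right_end_def clustered_zero_def zero_from_right_def short_def)
  then show "n (0 + 1) = 2"
    by (simp add: zero_from_left_def)
  show "short (n (0 + 2))"
    using r c(2) step_int[of n c "1"]
    by (auto simp: zero_from_left_def flux_def short_def split: if_splits)
next
  show "\<not> (short (n (0 - 2)) \<and> n (0 - 1) = 0 \<and> n 0 = 2 \<and> n (0 + 1) = 0 \<and> short (n (0 + 2)))"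
    using nm step_int[of n c 0]
    by (auto simp: zero_from_left_def zero_from_right_def flux_def short_def)
qed

lemma translate_apply: "translate k n i = n (i + k)"
  by (simp add: translate_def)

lemma regular_translate: "regular 0 (translate k n) = regular k n"
  by (simp add: regular_def left_end_def right_end_def translate_apply algebra_simps)

lemma TISD:
  assumes "TIS M"
  shows "state M" "stationary M" "translation_invariant M"
  using assms by (auto simp: TIS_def)

lemma AE_regular:
  assumes "TIS M"
  shows "AE n in M. \<forall>k. regular k n"
proof -
  note M = TISD[OF assms]
  note [measurable_cong] = stateD(2)[OF M(1)]
  interpret M: prob_space M by (rule stateD(1)[OF M(1)])
  interpret coins: prob_space coins by (rule prob_space_coins)
  interpret P: pair_prob_space M coins ..
  let ?P = "M \<Otimes>\<^sub>M coins"
  have space: "space ?P = UNIV"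
    by (simp add: space_pair_measure stateD(3)[OF M(1)])
  have sets: "sets ?P = sets (borel \<Otimes>\<^sub>M coins)"
    by (rule sets_pair_measure_cong[OF stateD(2)[OF M(1)] refl])
  have ev: "{(n, c). Q n c} \<in> P.events" if "Measurable.pred (borel \<Otimes>\<^sub>M coins) (\<lambda>(n, c). Q n c)" for Q
    using that unfolding sets by (simp add: pred_def space_pair_measure case_prod_unfold)
  define Z Z' K where "Z = {(n, c :: int \<Rightarrow> bool). clustered_zero 0 n}"
    and "Z' = {(n, c). clustered_zero 0 (ssm_step n c)}"
    and "K = {(n, c). clustered_zero 0 n \<and> ssm_step n c 0 = 0}"
  define R L where "R k = {(n, c). zero_from_right k n c}" and "L k = {(n, c). zero_from_left k n c}" for k
  have cz: "Measurable.pred borel (clustered_zero 0)"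
    unfolding clustered_zero_def by measurable
  have zr: "Measurable.pred (borel \<Otimes>\<^sub>M coins) (\<lambda>(n, c). zero_from_right k n c)" for k
    unfolding zero_from_right_def case_prod_beta by measurable
  have zl: "Measurable.pred (borel \<Otimes>\<^sub>M coins) (\<lambda>(n, c). zero_from_left k n c)" for k
    unfolding zero_from_left_def case_prod_beta by measurable
  have e: "Z \<in> P.events" "Z' \<in> P.events" "K \<in> P.events" "R k \<in> P.events" "L k \<in> P.events" for k
    unfolding Z_def Z'_def K_def R_def L_def
    by (intro ev zr zl; unfold clustered_zero_def case_prod_beta; measurable)+
  have pZ: "P.prob Z' = P.prob Z"
    unfolding Z_def Z'_def measure_step[OF M(1,2) cz] measure_joint_fst[OF M(1) cz] ..
  have shift: "zero_from_right k (translate j n) (\<lambda>i. c (i + j)) = zero_from_right (k + j) n c"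
    "zero_from_left k (translate j n) (\<lambda>i. c (i + j)) = zero_from_left (k + j) n c" for k j n c
    by (simp_all add: zero_from_right_def zero_from_left_def step_translate translate_apply algebra_simps)
  have pR: "P.prob (R (0 + j)) = P.prob (R 0)" and pL: "P.prob (L (0 + j)) = P.prob (L 0)" for j
    unfolding R_def L_def
    using joint_translate[OF M(1,3) zr, of 0 j] joint_translate[OF M(1,3) zl, of 0 j]
    by (simp_all only: shift)
  have sub: "Z' \<subseteq> K \<union> (R 0 \<union> L 0)"
  proof
    fix x assume "x \<in> Z'"
    then show "x \<in> K \<union> (R 0 \<union> L 0)"
      using clustered_zero_step[of 0 "fst x" "snd x"]
      by (auto simp: Z'_def K_def R_def L_def clustered_zero_def)
  qed
  have n': "ssm_step n c 0 = 1" if "zero_from_right (- 1) n c" for n c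
    using that step_int[of n c 0] by (auto simp: zero_from_right_def flux_def short_def)
  have n'': "ssm_step n c 0 = 1" if "zero_from_left 1 n c" for n c
    using that step_int[of n c 0] by (auto simp: zero_from_left_def flux_def short_def)
  have sub': "K \<union> (R (- 1) \<union> L 1) \<subseteq> Z"
    by (auto simp: K_def R_def L_def Z_def clustered_zero_def zero_from_right_def zero_from_left_def)
  have disj: "K \<inter> (R (- 1) \<union> L 1) = {}"
    by (auto simp: K_def R_def L_def dest: n' n'')
  have disj': "R (- 1) \<inter> L 1 = {}"
    by (auto simp: R_def L_def zero_from_right_def zero_from_left_def short_def)
  \<comment> \<open>A zero leaving the origin goes to -1 or 1, which is \<open>R (- 1)\<close> or
    \<open>L 1\<close>; a zero arriving at the origin gives \<open>R 0\<close> or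
    \<open>L 0\<close>. Departures and arrivals are translates of each other.\<close>
  have "P.prob (R 0) = P.prob (R (- 1))" "P.prob (L 0) = P.prob (L 1)"
    using pR[of "- 1"] pL[of 1] by simp_all
  from P.prob_balance[OF e(1,2,3) e(4)[of "- 1"] e(4)[of 0] e(5)[of 1] e(5)[of 0] sub sub' disj disj' pZ this]
  have "AE x in ?P. x \<notin> Z - (K \<union> (R (- 1) \<union> L 1))" "AE x in ?P. x \<notin> R 0 \<inter> L 0"
    using e by (simp_all add: P.prob_eq_0 space)
  then have "AE x in ?P. x \<notin> Z - (K \<union> (R (- 1) \<union> L 1)) \<and> x \<notin> R 0 \<inter> L 0"
    by eventually_elim blast
  from AE_pair_coins[OF M.prob_space_axioms this]
  have "AE n in M. regular 0 n"
  proof eventually_elim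
    case (elim n)
    \<comment> \<open>The pattern makes the coin at -2 point right and the coin at 1 point
      left.\<close>
    have "AE c in coins. (\<forall>j\<in>{- 2, 1}. c j = (j = - 2)) \<longrightarrow> regular 0 n"
      using elim
    proof eventually_elim
      case (elim c)
      then show ?case
        by (intro impI regularI[of n c]) (auto simp: Z_def K_def R_def L_def)
    qed
    then show ?case
      by (rule AE_coins_pattern) simp
  qed
  then show ?thesis
    by (rule translate_AE_all[OF M(1,3)]) (rule regular_translate)
qed

section \<open>Deterministic motion of the ends of runs\<close>

text \<open>By regularity the stack at \<open>k - 1\<close> has height 2 and gives a particle to the
  short stack on either side, whatever the coins. The stack at \<open>k - 2\<close> becomes tall: if
  it was empty, the exclusion of mergers makes \<open>k - 3\<close> tall, and a second particle
  comes from there.\<close>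

lemma left_end_step:
  assumes r: "\<And>k. regular k n" and l: "left_end k n"
  shows "left_end (k - 1) (ssm_step n c)" "n (k - 1) = 2" "short (n (k - 2))"
proof -
  have n: "n (k - 1) = 2" "short (n (k - 2))" "n k = 0" "short (n (k + 1))"
    using r[of k] l by (auto simp: regular_def left_end_def)
  have f: "flux n c (k - 1) = 1" "flux n c (k - 2) = - 1" "flux n c k = 0"
    using n by (auto simp: flux_def short_def)
  have 1: "ssm_step n c k = 1" "ssm_step n c (k - 1) = 0"
    using step_int[of n c k] step_int[of n c "k - 1"] n f by simp_all
  have "n (k - 2) = 0 \<Longrightarrow> \<not> short (n (k - 3))"
    using r[of "k - 1"] n by (auto simp: regular_def add.commute)
  then have "\<not> short (ssm_step n c (k - 2))"
    using step_int[of n c "k - 2"] n f by (auto simp: flux_def[of n c "k - 3"] short_def split: if_splits)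
  then show "left_end (k - 1) (ssm_step n c)"
    using 1 by (simp add: left_end_def short_def)
  show "n (k - 1) = 2" "short (n (k - 2))"
    using n by auto
qed

lemma right_end_step:
  assumes r: "\<And>k. regular k n" and l: "right_end k n"
  shows "right_end (k + 1) (ssm_step n c)"
proof -
  have n: "n (k + 1) = 2" "short (n (k + 2))" "n k = 0" "short (n (k - 1))"
    using r[of k] l by (auto simp: regular_def right_end_def)
  have f: "flux n c (k - 1) = 0" "flux n c (k + 1) = 1" "flux n c k = - 1"
    using n by (auto simp: flux_def short_def add.assoc)
  have 1: "ssm_step n c k = 1" "ssm_step n c (k + 1) = 0"
    using step_int[of n c k] step_int[of n c "k + 1"] n f by simp_all
  have "n (k + 2) = 0 \<Longrightarrow> \<not> short (n (k + 3))"
    using r[of "k + 1"] n by (auto simp: regular_def add.assoc)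
  then have "\<not> short (ssm_step n c (k + 2))"
    using step_int[of n c "k + 2"] n f by (auto simp: flux_def[of n c "k + 2"] short_def algebra_simps split: if_splits)
  then show "right_end (k + 1) (ssm_step n c)"
    using 1 by (simp add: right_end_def short_def add.assoc)
qed

text \<open>The ends approach each other by two sites per step and would finally stand at distance 0
  or 1, where their definitions contradict each other. Stationarity carries the exclusion at
  distance \<open>d\<close> back to distance \<open>d + 2\<close>, hence the induction in steps of
  two.\<close>

lemma AE_no_collision:
  assumes "TIS M"
  shows "AE n in M. \<forall>k. \<not> (right_end k n \<and> left_end (k + int d) n)"
proof (induction d rule: induct_nat_012)
  case (ge2 d)
  note M = TISD[OF assms]
  have "AE n in M. AE c in coins. \<forall>k. \<not> (right_end k (ssm_step n c) \<and> left_end (k + int d) (ssm_step n c))"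
    by (rule stationary_AE[OF M(1,2) ge2(1)])
  with AE_regular[OF assms] show ?case
  proof eventually_elim
    case (elim n)
    show ?case
    proof (intro allI notI)
      fix k assume "right_end k n \<and> left_end (k + int (Suc (Suc d))) n"
      then have "right_end (k + 1) (ssm_step n c)" "left_end (k + 1 + int d) (ssm_step n c)" for c
        using right_end_step[of n k c] left_end_step(1)[of n "k + int (Suc (Suc d))" c] elim(1)
        by (auto simp: algebra_simps)
      \<comment> \<open>No coin affects the motion of the two ends, so the empty pattern
        suffices.\<close>
      then have "AE c in coins. (\<forall>j\<in>{}. c j = True) \<longrightarrow> False"
        using elim(2) by (auto elim!: eventually_mono)
      then show False
        by (rule AE_coins_pattern) simp
    qed
  qed
qed (auto simp: left_end_def right_end_def short_def)

section \<open>The surplus of particles to the left of a left end\<close>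

text \<open>Subtracting one per site makes the sum insensitive to the motion of a left end at
  \<open>k\<close>: the interval loses a site of height 2, and the particle this site sends to the
  left makes up for the loss.\<close>

definition excess :: "int \<Rightarrow> int \<Rightarrow> config \<Rightarrow> int" where
  "excess j k n = (\<Sum>i\<in>{j..<k}. int (n i) - 1)"

lemma excess_split:
  assumes "j < k"
  shows "excess j k n = int (n j) - 1 + excess (j + 1) k n"
proof -
  have "{j..<k} = insert j {j + 1..<k}"
    using assms by auto
  then show ?thesis
    by (simp add: excess_def)
qed

lemma excess_split_last:
  assumes "j < k"
  shows "excess j k n = excess j (k - 1) n + int (n (k - 1)) - 1"
proof -
  have "{j..<k} = insert (k - 1) {j..<k - 1}"
    using assms by auto
  then show ?thesis
    by (simp add: excess_def)
qed

lemma excess_step: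
  assumes "j \<le> k"
  shows "excess j k (ssm_step n c) = excess j k n + flux n c (j - 1) - flux n c (k - 1)"
  using assms
proof (induction k rule: int_ge_induct)
  case (step k)
  then show ?case
    using excess_split_last[of j "k + 1" n] excess_split_last[of j "k + 1" "ssm_step n c"] step_int[of n c k]
    by simp
qed (simp add: excess_def)

text \<open>The two sums are added because a single one may alternate between two values in time. With the
  coins at \<open>j - 1\<close> and \<open>j\<close> pointing right, the left-moving end carries the total of the two
  along undiminished, up to parity, until it reaches \<open>j\<close>.\<close>

lemma excess_bound_step:
  assumes r: "\<And>k. regular k n" and l: "left_end k n" and nr: "\<not> right_end j n" and j: "j + 1 \<le> k - 1"
    and c: "c (j - 1)" "c j"
    and b: "excess j (k - 1) (ssm_step n c) + excess (j + 1) (k - 1) (ssm_step n c) \<le> 2"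
  shows "excess j k n + excess (j + 1) k n \<le> 2"
proof -
  note n = left_end_step(2,3)[OF r l]
  have f: "flux n c (k - 2) = - 1"
    using n by (simp add: flux_def short_def)
  have "excess j k n = excess j (k - 1) n + 1" "excess (j + 1) k n = excess (j + 1) (k - 1) n + 1"
    using excess_split_last[of j k n] excess_split_last[of "j + 1" k n] n j by simp_all
  then have *: "excess j k n + flux n c (j - 1) + (excess (j + 1) k n + flux n c j) \<le> 2"
    using b excess_step[of j "k - 1" n c] excess_step[of "j + 1" "k - 1" n c] j f by simp
  have s: "excess j k n = int (n j) - 1 + excess (j + 1) k n"
    using excess_split[of j k n] j by simp
  show ?thesis
  proof (rule ccontr)
    assume a: "\<not> ?thesis"
    then have "flux n c (j - 1) + flux n c j < 0"
      using * by simp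
    \<comment> \<open>Against the coins a flux is -1 only from a tall stack into a short one on its
      left. Two consecutive bonds cannot both be of this kind, and if the first is, the second has
      flux 1; only the second can be.\<close>
    then have sh: "short (n (j - 1)) \<and> short (n j) \<and> \<not> short (n (j + 1)) \<and> flux n c (j - 1) + flux n c j = - 1"
      using c by (auto simp: flux_def split: if_splits)
    then have "n j = 1"
      using nr by (auto simp: right_end_def short_def)
    \<comment> \<open>With \<open>n j = 1\<close> the two sums are equal and their total is even,
      while the flux estimate bounds it by 3.\<close>
    then show False
      using a s * sh by simp
  qed
qed

text \<open>After a step the end stands at \<open>k - 1\<close>, and the bound for \<open>d\<close>
  holds there by stationarity. Read backwards under suitable coins, it becomes the bound for
  \<open>d + 1\<close> at \<open>k\<close>. The start is the single stack of height 2 next to the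
  end.\<close>

lemma AE_excess_bound:
  assumes "TIS M"
  shows "AE n in M. \<forall>k. left_end k n \<longrightarrow> excess (k - 1 - int d) k n + excess (k - int d) k n \<le> 2"
proof (induction d)
  case 0
  show ?case
    using AE_regular[OF assms]
  proof eventually_elim
    case (elim n)
    have "excess (k - 1) k n = int (n (k - 1)) - 1" "excess k k n = 0" for k
      using excess_split_last[of "k - 1" k n] by (simp_all add: excess_def)
    then show ?case
      using left_end_step(2)[of n] elim by auto
  qed
next
  case (Suc d)
  note M = TISD[OF assms]
  have "AE n in M. \<forall>d k. \<not> (right_end k n \<and> left_end (k + int d) n)"
    by (subst AE_all_countable) (intro allI AE_no_collision[OF assms])
  with AE_regular[OF assms] stationary_AE[OF M(1,2) Suc] show ?case
  proof eventually_elim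
    case (elim n)
    show ?case
    proof (intro allI impI)
      fix k assume l: "left_end k n"
      define j where "j = k - 2 - int d"
      have "\<not> right_end j n"
        using elim(3)[rule_format, of j "d + 2"] l by (simp add: j_def)
      then have bound: "excess j k n + excess (j + 1) k n \<le> 2"
        if "c (j - 1)" "c j" and b: "\<forall>k. left_end k (ssm_step n c) \<longrightarrow>
          excess (k - 1 - int d) k (ssm_step n c) + excess (k - int d) k (ssm_step n c) \<le> 2" for c
        using that(1,2) b[rule_format, of "k - 1"] elim(1) l left_end_step(1)[of n k c]
        by (intro excess_bound_step[of n k j c]) (auto simp: j_def algebra_simps)
      have "AE c in coins. (\<forall>i\<in>{j - 1, j}. c i = True) \<longrightarrow> excess j k n + excess (j + 1) k n \<le> 2"
        using elim(2)
      proof eventually_elim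
        case (elim c)
        show ?case
          by (intro impI bound[OF _ _ elim]) simp_all
      qed
      then have "excess j k n + excess (j + 1) k n \<le> 2"
        by (rule AE_coins_pattern) simp
      then show "excess (k - 1 - int (Suc d)) k n + excess (k - int (Suc d)) k n \<le> 2"
        by (simp add: j_def algebra_simps)
    qed
  qed
qed

section \<open>Densities of single configurations, and the exclusion of left ends\<close>

definition density_at :: "real \<Rightarrow> config \<Rightarrow> bool" where
  "density_at \<rho> n \<longleftrightarrow>
     (\<lambda>N::nat. (\<Sum>i\<in>{1..int N}. real (n i)) / real N) \<longlonglongrightarrow> \<rho> \<and>
     (\<lambda>N::nat. (\<Sum>i\<in>{- int N..-1}. real (n i)) / real N) \<longlonglongrightarrow> \<rho>"

lemma has_density_iff: "has_density M \<rho> \<longleftrightarrow> (AE n in M. density_at \<rho> n)"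
  by (simp add: has_density_def density_at_def)

text \<open>With countable quantifiers only, so that convergence of measurable averages is a
  measurable event.\<close>

lemma LIMSEQ_countable:
  fixes X :: "nat \<Rightarrow> real"
  shows "X \<longlonglongrightarrow> L \<longleftrightarrow> (\<forall>m. \<exists>N0. \<forall>N. N0 \<le> N \<longrightarrow> \<bar>X N - L\<bar> < inverse (real (Suc m)))"
proof
  assume X: "X \<longlonglongrightarrow> L"
  show "\<forall>m. \<exists>N0. \<forall>N. N0 \<le> N \<longrightarrow> \<bar>X N - L\<bar> < inverse (real (Suc m))"
  proof
    fix m
    show "\<exists>N0. \<forall>N. N0 \<le> N \<longrightarrow> \<bar>X N - L\<bar> < inverse (real (Suc m))"
      using LIMSEQ_D[OF X, of "inverse (real (Suc m))"] by simp
  qed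
next
  assume *: "\<forall>m. \<exists>N0. \<forall>N. N0 \<le> N \<longrightarrow> \<bar>X N - L\<bar> < inverse (real (Suc m))"
  show "X \<longlonglongrightarrow> L"
  proof (rule LIMSEQ_I)
    fix r :: real assume "0 < r"
    then obtain m where m: "inverse (real (Suc m)) < r"
      using reals_Archimedean by blast
    obtain N0 where "\<forall>N. N0 \<le> N \<longrightarrow> \<bar>X N - L\<bar> < inverse (real (Suc m))"
      using * by blast
    then show "\<exists>N0. \<forall>N\<ge>N0. norm (X N - L) < r"
      using m by (intro exI[of _ N0]) force
  qed
qed

lemma measurable_density_at [measurable]: "Measurable.pred borel (density_at \<rho>)"
proof -
  have [measurable]: "(\<lambda>n::config. real (n i)) \<in> borel_measurable borel" for i
    by (rule measurable_compose[OF measurable_site]) simp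
  show ?thesis
    unfolding density_at_def LIMSEQ_countable by measurable
qed

lemma AE_no_left_end:
  assumes "TIS M" "has_density M \<rho>" "\<rho> > 1"
  shows "AE n in M. \<forall>k. \<not> left_end k n"
proof -
  note M = TISD[OF assms(1)]
  have "AE n in M. \<forall>d k. left_end k n \<longrightarrow> excess (k - 1 - int d) k n + excess (k - int d) k n \<le> 2"
    by (subst AE_all_countable) (rule allI, rule AE_excess_bound[OF assms(1)])
  with assms(2)[unfolded has_density_iff] have "AE n in M. \<not> left_end 0 n"
  proof eventually_elim
    case (elim n)
    show ?case
    proof
      assume l: "left_end 0 n"
      let ?avg = "\<lambda>N::nat. (\<Sum>i\<in>{- int N..-1}. real (n i)) / real N"
      have "eventually (\<lambda>N. (1 + \<rho>) / 2 < ?avg N) sequentially"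
        using elim(1) assms(3) by (intro order_tendstoD) (auto simp: density_at_def)
      then obtain N0 where N0: "(1 + \<rho>) / 2 < ?avg N" if "N0 \<le> N" for N
        unfolding eventually_sequentially by blast
      \<comment> \<open>An average above \<open>(1 + \<rho>) / 2\<close> gives \<open>N\<close>
        sites a surplus above \<open>N * (\<rho> - 1) / 2\<close>, which exceeds 2 once
        \<open>N > 4 / (\<rho> - 1)\<close>.\<close>
      obtain N1 :: nat where N1: "4 / (\<rho> - 1) < real N1"
        using reals_Archimedean2 by blast
      have big: "2 \<le> excess (- int N) 0 n" if N: "N0 \<le> N" "N1 \<le> N" "0 < N" for N
      proof -
        have "4 / (\<rho> - 1) < real N"
          using N1 N(2) by linarith
        then have "4 < real N * (\<rho> - 1)"
          using assms(3) by (simp add: field_simps)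
        moreover have "real N * ((1 + \<rho>) / 2) < (\<Sum>i\<in>{- int N..-1}. real (n i))"
          using N0[OF N(1)] N(3) by (simp add: field_simps)
        moreover have "{- int N..<0} = {- int N..-1}"
          by auto
        then have "real_of_int (excess (- int N) 0 n) = (\<Sum>i\<in>{- int N..-1}. real (n i)) - real N"
          by (simp add: excess_def sum_subtractf)
        ultimately have "2 < real_of_int (excess (- int N) 0 n)"
          by (simp add: field_simps)
        then show ?thesis
          by linarith
      qed
      let ?d = "Suc (N0 + N1)"
      have "2 \<le> excess (- int (Suc ?d)) 0 n" "2 \<le> excess (- int ?d) 0 n"
        by (intro big; simp)+
      moreover have "excess (- int (Suc ?d)) 0 n + excess (- int ?d) 0 n \<le> 2"
        using elim(2)[rule_format, OF l, of ?d] by (simp add: algebra_simps)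
      ultimately show False
        by simp
    qed
  qed
  then show ?thesis
    by (rule translate_AE_all[OF M(1,3)]) (simp add: left_end_def translate_apply algebra_simps)
qed

section \<open>Reflection of space and the exclusion of right ends\<close>

definition reflect :: "config \<Rightarrow> config" where
  "reflect n = (\<lambda>i. n (- i))"

lemma measurable_reflect [measurable]: "reflect \<in> borel \<rightarrow>\<^sub>M borel"
  unfolding reflect_def by (rule measurable_config) measurable

text \<open>The mirror image of the bond from \<open>i\<close> to \<open>i + 1\<close> has left
  endpoint \<open>- i - 1\<close>, and its direction is reversed; hence the index and the negation
  of the coin.\<close>

lemma step_reflect: "ssm_step (reflect n) (\<lambda>i. c (- i - 1) \<noteq> True) = reflect (ssm_step n c)"
proof
  fix i
  have f: "flux (reflect n) (\<lambda>i. c (- i - 1) \<noteq> True) i = - flux n c (- i - 1)" for i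
    by (auto simp: flux_def reflect_def)
  show "ssm_step (reflect n) (\<lambda>i. c (- i - 1) \<noteq> True) i = reflect (ssm_step n c) i"
    unfolding ssm_step_def f by (simp add: reflect_def algebra_simps)
qed

lemma density_at_reflect: "density_at \<rho> (reflect n) \<longleftrightarrow> density_at \<rho> n"
proof -
  have "(\<Sum>i\<in>{1..int N}. real (n (- i))) = (\<Sum>i\<in>{- int N..-1}. real (n i))"
    "(\<Sum>i\<in>{- int N..-1}. real (n (- i))) = (\<Sum>i\<in>{1..int N}. real (n i))" for N
    by (rule sum.reindex_bij_witness[of _ uminus uminus]; auto)+
  then show ?thesis
    by (auto simp: density_at_def reflect_def)
qed

lemma AE_distr_config:
  assumes "state M" "f \<in> borel \<rightarrow>\<^sub>M borel" "Measurable.pred borel Q"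
  shows "(AE n in distr M borel f. Q n) \<longleftrightarrow> (AE n in M. Q (f n))"
  using assms by (intro AE_distr_iff) (auto simp: measurable_cong_sets[OF stateD(2) refl] pred_def)

lemma TIS_reflect:
  assumes "TIS M"
  shows "TIS (distr M borel reflect)"
proof -
  note M = TISD[OF assms]
  note [measurable_cong] = stateD(2)[OF M(1)]
  have m: "reflect \<in> M \<rightarrow>\<^sub>M borel" "translate k \<in> M \<rightarrow>\<^sub>M borel" for k
    by measurable
  have "stationary (distr M borel reflect)"
  proof (rule stationary_distr[OF M(1,2) measurable_reflect])
    show "(\<lambda>c i. c (- i - 1) \<noteq> True) \<in> coins \<rightarrow>\<^sub>M coins"
      by (rule measurable_coins) measurable
    show "distr coins coins (\<lambda>c i. c (- i - 1) \<noteq> True) = coins"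
      by (rule coins_symmetric) (simp add: inj_on_def)
    show "AE n in M. \<forall>c. ssm_step (reflect n) (\<lambda>i. c (- i - 1) \<noteq> True) = reflect (ssm_step n c)"
      using step_reflect by blast
  qed
  moreover have "translation_invariant (distr M borel reflect)"
    unfolding translation_invariant_def
  proof
    fix k
    have "translate k \<circ> reflect = reflect \<circ> translate (- k)"
      by (auto simp: translate_def reflect_def fun_eq_iff)
    then have "distr (distr M borel reflect) borel (translate k) = distr (distr M borel (translate (- k))) borel reflect"
      using m by (simp add: distr_distr)
    then show "distr (distr M borel reflect) borel (translate k) = distr M borel reflect"
      using M(3) by (simp add: translation_invariant_def)
  qed
  ultimately show ?thesis
    using state_distr[OF stateD(1)[OF M(1)] m(1)] by (simp add: TIS_def)
qed

lemma AE_no_right_end: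
  assumes "TIS M" "has_density M \<rho>" "\<rho> > 1"
  shows "AE n in M. \<forall>k. \<not> right_end k n"
proof -
  note M = TISD[OF assms(1)]
  have "has_density (distr M borel reflect) \<rho>"
    using assms(2) by (simp add: has_density_iff AE_distr_config[OF M(1)] density_at_reflect)
  from AE_no_left_end[OF TIS_reflect[OF assms(1)] this assms(3)]
  have "AE n in M. \<forall>k. \<not> left_end k (reflect n)"
    by (subst (asm) AE_distr_config[OF M(1)]) (auto simp: left_end_def)
  then show ?thesis
  proof eventually_elim
    case (elim n)
    then show ?case
      using elim[rule_format, of "- k" for k]
      by (auto simp: left_end_def right_end_def reflect_def algebra_simps)
  qed
qed

section \<open>The absence of adjacent short stacks\<close>

text \<open>A tall stack next to a short one pushes a particle onto it. For the receiver to remain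
  short it must have been empty with its other bond frozen, that is, a left or right end. So the
  pair was already short, and no tall stack stood at 2.\<close>

lemma frozen_bond_step:
  assumes "\<And>k. \<not> left_end k n" "\<And>k. \<not> right_end k n"
    and "short (ssm_step n c 0)" "short (ssm_step n c 1)"
  shows "short (n 0) \<and> short (n 1) \<and> short (n 2)"
  using assms(1)[of 0] assms(2)[of 0] assms(1)[of 1] assms(2)[of 1] assms(3,4)
    step_int[of n c 0] step_int[of n c 1]
  by (auto simp: left_end_def right_end_def flux_def short_def split: if_splits)

text \<open>Once ends are excluded, short pairs after a step come from short triples before it. By
  stationarity pairs are then no more likely than triples, although they contain them, so a short
  pair almost surely extends by one site. It thus extends forever to the right, where the average
  would be at most 1.\<close>

theorem TIS_AE_Xstar:
  assumes "TIS M" "has_density M \<rho>" "\<rho> > 1"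
  shows "AE n in M. n \<in> Xstar"
proof -
  note M = TISD[OF assms(1)]
  note [measurable_cong] = stateD(2)[OF M(1)]
  interpret M: prob_space M by (rule stateD(1)[OF M(1)])
  interpret coins: prob_space coins by (rule prob_space_coins)
  interpret P: pair_prob_space M coins ..
  let ?b = "\<lambda>k n. short (n k) \<and> short (n (k + 1 :: int))"
  let ?t = "\<lambda>n. short (n (0::int)) \<and> short (n 1) \<and> short (n 2)"
  have mb: "Measurable.pred borel (\<lambda>n::config. ?b 0 n)" and mt: "Measurable.pred borel (\<lambda>n::config. ?t n)"
    by measurable
  have "P.prob {(n, c). ?b 0 (ssm_step n c)} \<le> P.prob {(n, c). ?t n}"
  proof (rule P.finite_measure_mono_AE)
    have "AE n in M. (\<forall>k. \<not> left_end k n) \<and> (\<forall>k. \<not> right_end k n)"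
      using AE_no_left_end[OF assms] AE_no_right_end[OF assms] by eventually_elim blast
    from AE_fst[OF prob_space_coins this]
    show "AE x in M \<Otimes>\<^sub>M coins. x \<in> {(n, c). ?b 0 (ssm_step n c)} \<longrightarrow> x \<in> {(n, c). ?t n}"
    proof eventually_elim
      case (elim x)
      then show ?case
        using frozen_bond_step[of "fst x" "snd x"] by auto
    qed
    have "Measurable.pred (M \<Otimes>\<^sub>M coins) (\<lambda>x. ?t (fst x))"
      by measurable
    then show "{(n, c). ?t n} \<in> P.events"
      by (simp add: pred_def space_pair_measure stateD(3)[OF M(1)] case_prod_unfold)
  qed
  then have "M.prob {n. ?b 0 n} \<le> M.prob {n. ?t n}"
    unfolding measure_step[OF M(1,2) mb] measure_joint_fst[OF M(1) mt] .
  moreover have e: "{n. ?b 0 n} \<in> M.events" "{n. ?t n} \<in> M.events"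
    using mb mt by (simp_all add: pred_def stateD(2)[OF M(1)])
  then have "M.prob ({n. ?b 0 n} - {n. ?t n}) = M.prob {n. ?b 0 n} - M.prob {n. ?t n}"
    by (intro M.finite_measure_Diff) auto
  ultimately have "M.prob ({n. ?b 0 n} - {n. ?t n}) = 0"
    using measure_nonneg[of M "{n. ?b 0 n} - {n. ?t n}"] by linarith
  then have "AE n in M. n \<notin> {n. ?b 0 n} - {n. ?t n}"
    using e by (subst (asm) M.prob_eq_0) auto
  then have "AE n in M. ?b 0 n \<longrightarrow> ?b (0 + 1) n"
    by eventually_elim auto
  then have "AE n in M. \<forall>k. ?b k n \<longrightarrow> ?b (k + 1) n"
    by (rule translate_AE_all[OF M(1,3), where Q = "\<lambda>k n. ?b k n \<longrightarrow> ?b (k + 1) n"])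
       (simp add: translate_apply algebra_simps)
  with assms(2)[unfolded has_density_iff] have "AE n in M. \<not> ?b 0 n"
  proof eventually_elim
    case (elim n)
    show ?case
    proof
      assume b: "?b 0 n"
      have "?b (int k) n" for k
      proof (induction k)
        case 0
        then show ?case using b by simp
      next
        case (Suc k)
        then show ?case using elim(2) by (simp add: add.commute)
      qed
      then have le: "real (n i) \<le> 1" if "1 \<le> i" for i
        using that zero_le_imp_eq_int[of i] by (force simp: short_def)
      have "(\<Sum>i\<in>{1..int N}. real (n i)) / real N \<le> 1" for N
      proof -
        have "(\<Sum>i\<in>{1..int N}. real (n i)) \<le> real (card {1..int N}) * 1"
          by (rule sum_bounded_above) (use le in auto)
        then show ?thesis
          by (simp add: divide_le_eq)
      qed
      then have "\<rho> \<le> 1"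
        using elim(1) by (intro LIMSEQ_le_const2[of _ \<rho>]) (auto simp: density_at_def)
      then show False
        using assms(3) by simp
    qed
  qed
  then have "AE n in M. \<forall>k. \<not> ?b k n"
    by (rule translate_AE_all[OF M(1,3), where Q = "\<lambda>k n. \<not> ?b k n"])
       (simp add: translate_apply algebra_simps)
  then show ?thesis
    by (simp add: Xstar_def)
qed

section \<open>The ergodic theorem for bounded functions\<close>

text \<open>The maximum of \<open>birkhoff_sum T g k x\<close> over \<open>k \<le> n\<close>, in the
  recursive form that compares the point \<open>x\<close> with \<open>T x\<close>.\<close>

primrec max_sum :: "('a \<Rightarrow> 'a) \<Rightarrow> ('a \<Rightarrow> real) \<Rightarrow> nat \<Rightarrow> 'a \<Rightarrow> real" where
  "max_sum T g 0 = (\<lambda>x. 0)"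
| "max_sum T g (Suc n) = (\<lambda>x. max 0 (g x + max_sum T g n (T x)))"

definition birkhoff_sum :: "('a \<Rightarrow> 'a) \<Rightarrow> ('a \<Rightarrow> real) \<Rightarrow> nat \<Rightarrow> 'a \<Rightarrow> real" where
  "birkhoff_sum T g n x = (\<Sum>i<n. g ((T ^^ i) x))"

lemma birkhoff_sum_0 [simp]: "birkhoff_sum T g 0 x = 0"
  by (simp add: birkhoff_sum_def)

lemma birkhoff_sum_Suc: "birkhoff_sum T g (Suc n) x = g x + birkhoff_sum T g n (T x)"
  unfolding birkhoff_sum_def by (subst sum.lessThan_Suc_shift) (simp add: funpow_swap1)

lemma max_sum_nonneg: "0 \<le> max_sum T g n x"
  by (cases n) auto

lemma max_sum_mono: "max_sum T g n x \<le> max_sum T g (Suc n) x"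
proof (induction n arbitrary: x)
  case (Suc n)
  from this[of "T x"] show ?case
    by auto
qed simp

lemma birkhoff_sum_le_max_sum: "birkhoff_sum T g n x \<le> max_sum T g n x"
proof (induction n arbitrary: x)
  case (Suc n)
  from this[of "T x"] show ?case
    by (simp add: birkhoff_sum_Suc)
qed simp

lemma max_sum_le:
  assumes "\<And>x. \<bar>g x\<bar> \<le> C"
  shows "max_sum T g n x \<le> real n * C"
proof (induction n arbitrary: x)
  case (Suc n)
  have "0 \<le> C"
    using assms[of x] by linarith
  with Suc[of "T x"] assms[of x] show ?case
    by (auto simp: field_simps intro: add_nonneg_nonneg)
qed simp

locale measure_preserving_map = prob_space +
  fixes T
  assumes meas [measurable]: "T \<in> M \<rightarrow>\<^sub>M M"
    and preserves: "distr M M T = M"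
begin

lemma funpow_measurable [measurable]: "T ^^ i \<in> M \<rightarrow>\<^sub>M M"
  by (induction i) (auto intro: measurable_comp[OF _ meas])

lemma birkhoff_sum_measurable [measurable]:
  "g \<in> borel_measurable M \<Longrightarrow> birkhoff_sum T g n \<in> borel_measurable M"
  unfolding birkhoff_sum_def
  by (intro borel_measurable_sum measurable_compose[OF funpow_measurable])

lemma max_sum_measurable [measurable]:
  "g \<in> borel_measurable M \<Longrightarrow> max_sum T g n \<in> borel_measurable M"
  by (induction n) auto

lemma integral_compose: "g \<in> borel_measurable M \<Longrightarrow> (\<integral>x. g (T x) \<partial>M) = (\<integral>x. g x \<partial>M)" for g :: "'a \<Rightarrow> real"
  using integral_distr[OF meas, of g] by (simp add: preserves)

text \<open>Garsia's argument: \<open>max_sum T g (Suc n) x - max_sum T g n (T x)\<close> is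
  \<open>max (- max_sum T g n (T x)) (g x)\<close>, which converges to \<open>g x\<close> and has nonnegative integral.\<close>

lemma integral_nonneg_if_unbounded:
  assumes g [measurable]: "g \<in> borel_measurable M" and C: "\<And>x. \<bar>g x\<bar> \<le> C"
    and unb: "AE x in M. \<forall>B. \<exists>n. B < birkhoff_sum T g n x"
  shows "0 \<le> (\<integral>x. g x \<partial>M)"
proof -
  let ?m = "max_sum T g"
  define h where "h n x = ?m (Suc n) x - ?m n (T x)" for n x
  have h: "h n x = max (- ?m n (T x)) (g x)" for n x
    by (auto simp: h_def max_def)
  have bd: "\<bar>?m n x\<bar> \<le> real n * C" for n x
    using max_sum_le[of g C T n x] C max_sum_nonneg[of T g n x] by simp
  have im: "integrable M (?m n)" for n
    by (rule integrable_const_bound[where B = "real n * C"]) (use bd in auto)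
  have imT: "integrable M (\<lambda>x. ?m n (T x))" for n
    by (rule integrable_const_bound[where B = "real n * C"]) (use bd in auto)
  have "0 \<le> (\<integral>x. h n x \<partial>M)" for n
  proof -
    have "(\<integral>x. ?m n (T x) \<partial>M) = (\<integral>x. ?m n x \<partial>M)"
      by (rule integral_compose) measurable
    also have "\<dots> \<le> (\<integral>x. ?m (Suc n) x \<partial>M)"
      using im by (intro integral_mono max_sum_mono)
    finally show ?thesis
      unfolding h_def using Bochner_Integration.integral_diff[OF im[of "Suc n"] imT[of n]] by linarith
  qed
  moreover have "(\<lambda>n. \<integral>x. h n x \<partial>M) \<longlonglongrightarrow> (\<integral>x. g x \<partial>M)"
  proof (rule integral_dominated_convergence[where w = "\<lambda>_. C"])
    show "AE x in M. (\<lambda>n. h n x) \<longlonglongrightarrow> g x"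
      using unb
    proof eventually_elim
      case (elim x)
      \<comment> \<open>One \<open>C\<close> absorbs the first summand; the other leaves
        \<open>max_sum T g n (T x)\<close> above \<open>C\<close>, so that the maximum in
        \<open>h\<close> is \<open>g x\<close>.\<close>
      then obtain N where N: "2 * C < birkhoff_sum T g N x"
        by blast
      have C0: "0 \<le> C"
        using C[of x] by linarith
      obtain n0 where "N = Suc n0"
        using N C0 by (cases N) auto
      then have "C < ?m n0 (T x)"
        using N C[of x] birkhoff_sum_le_max_sum[of T g n0 "T x"] by (simp add: birkhoff_sum_Suc)
      moreover have "?m n0 (T x) \<le> ?m n (T x)" if "n0 \<le> n" for n
        using that by (rule lift_Suc_mono_le[of "\<lambda>n. ?m n (T x)", OF max_sum_mono])
      ultimately have "h n x = g x" if "n0 \<le> n" for n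
        using that C[of x] unfolding h by (smt (verit))
      then show ?case
        by (intro tendsto_eventually) (auto simp: eventually_sequentially)
    qed
    show "AE x in M. norm (h n x) \<le> C" for n
      using C max_sum_nonneg[of T g n] unfolding h by (intro AE_I2) (smt (verit) real_norm_def)
  qed (auto simp: h_def[abs_def])
  ultimately show ?thesis
    by (intro LIMSEQ_le_const) auto
qed

end

locale ergodic_map = measure_preserving_map +
  assumes ergodic: "A \<in> events \<Longrightarrow> T -` A \<inter> space M = A \<Longrightarrow> prob A = 0 \<or> prob A = 1"
begin

text \<open>Dropping the first summand does not affect unboundedness from above, which is thus a
  \<open>T\<close>-invariant event. If it had probability 1, the integral would be nonnegative; by
  ergodicity it has probability 0.\<close>

lemma AE_birkhoff_sum_bounded:
  assumes g [measurable]: "g \<in> borel_measurable M" and C: "\<And>x. \<bar>g x\<bar> \<le> C"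
    and neg: "(\<integral>x. g x \<partial>M) < 0"
  shows "AE x in M. \<exists>B. \<forall>n. birkhoff_sum T g n x \<le> B"
proof -
  let ?s = "birkhoff_sum T g"
  let ?unb = "\<lambda>x. \<forall>B. \<exists>n. B < ?s n x"
  have unb: "?unb x \<longleftrightarrow> (\<forall>B::nat. \<exists>n. real B < ?s n x)" for x
    by (meson less_trans reals_Archimedean2)
  define U where "U = {x \<in> space M. ?unb x}"
  have U: "U \<in> events"
    unfolding U_def unb by measurable
  have inv: "?unb (T x) \<longleftrightarrow> ?unb x" for x
  proof
    assume *: "?unb (T x)"
    show "?unb x"
    proof
      fix B
      obtain n where "B - g x < ?s n (T x)"
        using * by blast
      then show "\<exists>n. B < ?s n x"
        by (intro exI[of _ "Suc n"]) (simp add: birkhoff_sum_Suc)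
    qed
  next
    assume *: "?unb x"
    show "?unb (T x)"
    proof
      fix B
      obtain n where n: "max 0 (B + g x) < ?s n x"
        using * by blast
      then obtain k where "n = Suc k"
        by (cases n) auto
      then show "\<exists>n. B < ?s n (T x)"
        using n by (intro exI[of _ k]) (simp add: birkhoff_sum_Suc)
    qed
  qed
  have "T -` U \<inter> space M = U"
    using inv measurable_space[OF meas] by (auto simp: U_def)
  from ergodic[OF U this] show ?thesis
  proof
    assume "prob U = 0"
    then have "AE x in M. x \<notin> U"
      using U by (subst (asm) prob_eq_0) auto
    then show ?thesis
      using AE_space by eventually_elim (auto simp: U_def not_less)
  next
    assume "prob U = 1"
    then have "AE x in M. x \<in> U"
      using U by (subst (asm) prob_eq_1) auto
    then have "AE x in M. ?unb x"
      by eventually_elim (simp add: U_def)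
    from integral_nonneg_if_unbounded[OF g C this] neg show ?thesis
      by simp
  qed
qed

text \<open>The deviation of \<open>f\<close> from its mean, lowered by \<open>1 / (m + 1)\<close>,
  has negative integral, so its sums are bounded above. Both signs of the deviation and all
  \<open>m\<close> together squeeze the averages.\<close>

theorem birkhoff:
  assumes f [measurable]: "f \<in> borel_measurable M" and C: "\<And>x. \<bar>f x\<bar> \<le> C"
  shows "AE x in M. (\<lambda>n. birkhoff_sum T f n x / real n) \<longlonglongrightarrow> (\<integral>x. f x \<partial>M)"
proof -
  let ?a = "\<integral>x. f x \<partial>M"
  have int: "integrable M f"
    by (rule integrable_const_bound[where B = C]) (use C in auto)
  have bounded: "AE x in M. \<forall>m. \<exists>B. \<forall>n. s * (birkhoff_sum T f n x - real n * ?a) \<le> real n / real (Suc m) + B"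
    if s: "s = 1 \<or> s = - 1" for s :: real
  proof (subst AE_all_countable, rule allI)
    fix m
    let ?g = "\<lambda>x. s * (f x - ?a) - 1 / real (Suc m)"
    have bd: "AE x in M. \<exists>B. \<forall>n. birkhoff_sum T ?g n x \<le> B"
    proof (rule AE_birkhoff_sum_bounded)
      show "\<bar>?g x\<bar> \<le> C + \<bar>?a\<bar> + 1 / real (Suc m)" for x
      proof -
        have "\<bar>s * (f x - ?a)\<bar> = \<bar>f x - ?a\<bar>" "0 \<le> 1 / real (Suc m)"
          using s by auto
        then show ?thesis
          using C[of x] by linarith
      qed
      show "(\<integral>x. ?g x \<partial>M) < 0"
        using int by (simp add: prob_space)
    qed measurable
    have e: "birkhoff_sum T ?g n x = s * (birkhoff_sum T f n x - real n * ?a) - real n / real (Suc m)" for n x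
      by (simp add: birkhoff_sum_def sum_subtractf sum_distrib_left right_diff_distrib)
    from bd show "AE x in M. \<exists>B. \<forall>n. s * (birkhoff_sum T f n x - real n * ?a) \<le> real n / real (Suc m) + B"
      unfolding e by eventually_elim (simp only: diff_le_eq add.commute)
  qed
  from bounded[of 1] bounded[of "- 1"] show ?thesis
  proof simp_all
    assume u: "AE x in M. \<forall>m. \<exists>B. \<forall>n. birkhoff_sum T f n x - real n * ?a \<le> real n / (1 + real m) + B"
      and l: "AE x in M. \<forall>m. \<exists>B. \<forall>n. real n * ?a - birkhoff_sum T f n x \<le> real n / (1 + real m) + B"
    from u l show ?thesis
    proof eventually_elim
      case (elim x)
      show ?case
      proof (rule LIMSEQ_I)
        fix r :: real assume r: "0 < r"
        then obtain m where m: "inverse (real (Suc m)) < r / 2"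
          using reals_Archimedean[of "r / 2"] by auto
        obtain B1 B2 where B1: "\<And>n. birkhoff_sum T f n x - real n * ?a \<le> real n / (1 + real m) + B1"
          and B2: "\<And>n. real n * ?a - birkhoff_sum T f n x \<le> real n / (1 + real m) + B2"
          using elim by meson
        obtain N :: nat where N: "2 * (\<bar>B1\<bar> + \<bar>B2\<bar>) / r < real N"
          using reals_Archimedean2 by blast
        show "\<exists>N. \<forall>n\<ge>N. norm (birkhoff_sum T f n x / real n - ?a) < r"
        proof (intro exI[of _ "Suc N"] allI impI)
          fix n assume n: "Suc N \<le> n"
          have "2 * (\<bar>B1\<bar> + \<bar>B2\<bar>) / r < real n"
            using N n by linarith
          then have b: "\<bar>B1\<bar> + \<bar>B2\<bar> < real n * (r / 2)"
            using r by (simp add: field_simps)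
          have "real n / (1 + real m) \<le> real n * (r / 2)"
            using mult_left_mono[OF less_imp_le[OF m], of "real n"] by (simp add: inverse_eq_divide)
          moreover have "real n * r = real n * (r / 2) + real n * (r / 2)"
            by simp
          ultimately have "\<bar>birkhoff_sum T f n x - real n * ?a\<bar> < real n * r"
            using B1[of n] B2[of n] b by linarith
          moreover have "birkhoff_sum T f n x / real n - ?a = (birkhoff_sum T f n x - real n * ?a) / real n"
            using n by (simp add: field_simps)
          ultimately show "norm (birkhoff_sum T f n x / real n - ?a) < r"
            using n by (simp add: abs_divide divide_less_eq mult.commute)
        qed
      qed
    qed
  qed
qed

end

section \<open>Consequences for translations of configurations\<close>

lemma translate_translate: "translate j (translate k n) = translate (j + k) n"
  by (simp add: translate_def algebra_simps)

lemma translate_0 [simp]: "translate 0 n = n"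
  by (simp add: translate_def)

lemma translate_funpow: "(translate a ^^ i) n = translate (int i * a) n"
  by (induction i) (simp_all add: translate_translate algebra_simps)

text \<open>Either unit shift generates all translations. This links ergodicity of a state, defined
  by the whole group, with ergodicity of a single map.\<close>

lemma translate_invariant_set:
  assumes "a = 1 \<or> a = - 1" and A: "translate a -` A = A"
  shows "translate k -` A = A"
proof -
  have i: "translate a n \<in> A \<longleftrightarrow> n \<in> A" for n
    using A by blast
  have pos: "translate (int j * a) n \<in> A \<longleftrightarrow> n \<in> A" for j n
  proof (induction j)
    case (Suc j)
    then show ?case
      using i[of "translate (int j * a) n"] by (simp add: translate_translate algebra_simps)
  qed simp
  have neg: "translate (- (int j * a)) n \<in> A \<longleftrightarrow> n \<in> A" for j n
    using pos[of j "translate (- (int j * a)) n"] by (simp add: translate_translate)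
  have "k = int (nat \<bar>k\<bar>) * a \<or> k = - (int (nat \<bar>k\<bar>) * a)"
    using assms(1) by auto
  then show ?thesis
    using pos[of "nat \<bar>k\<bar>"] neg[of "nat \<bar>k\<bar>"] by (metis (no_types, lifting) subsetI subset_antisym vimageE vimageI)
qed

lemma ergodic_map_translate:
  assumes M: "state M" "translation_invariant M" "ergodic M" and a: "a = 1 \<or> a = - 1"
  shows "ergodic_map M (translate a)"
proof -
  interpret prob_space M by (rule stateD(1)[OF M(1)])
  show ?thesis
  proof
    show "translate a \<in> M \<rightarrow>\<^sub>M M"
      using measurable_translate by (simp add: measurable_cong_sets[OF stateD(2) stateD(2)] M)
    have "distr M M (translate a) = distr M borel (translate a)"
      by (rule distr_cong) (simp_all add: stateD(2)[OF M(1)])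
    then show "distr M M (translate a) = M"
      using M(2) by (simp add: translation_invariant_def)
    fix A assume "A \<in> events" "translate a -` A \<inter> space M = A"
    then show "prob A = 0 \<or> prob A = 1"
      using M(3) translate_invariant_set[OF a, of A]
      by (simp add: ergodic_def stateD(2,3)[OF M(1)])
  qed
qed

lemma birkhoff_translate:
  assumes "state M" "translation_invariant M" "ergodic M" "a = 1 \<or> a = - 1"
    and "f \<in> borel_measurable borel" "\<And>n. \<bar>f n\<bar> \<le> C"
  shows "AE n in M. (\<lambda>N. (\<Sum>i<N. f (translate (int i * a) n)) / real N) \<longlonglongrightarrow> (\<integral>n. f n \<partial>M)"
  using ergodic_map.birkhoff[OF ergodic_map_translate[OF assms(1-4)], of f C] assms(5,6)
  by (simp add: birkhoff_sum_def translate_funpow measurable_cong_sets[OF stateD(2)[OF assms(1)] refl])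

lemma ergodic_has_density:
  assumes M: "state_on S M" "translation_invariant M" "ergodic M"
  shows "\<exists>\<kappa>. has_density M \<kappa>"
proof -
  have st: "state M" and AE_S: "AE n in M. n \<in> S"
    using M(1) by (auto simp: state_on_def)
  note [measurable_cong] = stateD(2)[OF st]
  \<comment> \<open>Truncation at 1 makes the height bounded everywhere and does not alter it on
    \<open>S\<close>.\<close>
  define f where "f a n = real (min 1 (n a))" for a :: int and n :: config
  have f [measurable]: "f a \<in> borel_measurable borel" for a
    unfolding f_def by (rule measurable_compose[OF measurable_site]) simp
  have b: "\<bar>f a n\<bar> \<le> 1" for a n
    by (simp add: f_def)
  \<comment> \<open>The averages to the left start at site -1, those to the right at site 1; a shift
    by 2 shows that their limits agree.\<close>
  have "(\<integral>n. f (- 1) n \<partial>M) = (\<integral>n. f (- 1) n \<partial>distr M borel (translate 2))"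
    using M(2) by (simp add: translation_invariant_def)
  also have "\<dots> = (\<integral>n. f (- 1) (translate 2 n) \<partial>M)"
    by (rule integral_distr) measurable
  finally have e: "(\<integral>n. f (- 1) n \<partial>M) = (\<integral>n. f 1 n \<partial>M)"
    by (simp add: f_def translate_apply)
  have "AE n in M. density_at (\<integral>n. f 1 n \<partial>M) n"
    using AE_S birkhoff_translate[OF st M(2,3) disjI1[OF refl] f b, of 1]
      birkhoff_translate[OF st M(2,3) disjI2[OF refl] f b, of "- 1"]
  proof eventually_elim
    case (elim n)
    have n: "real (min 1 (n i)) = real (n i)" for i
    proof -
      have "n i \<in> {0, 1}"
        using elim(1) by (simp add: S_def)
      then show ?thesis by auto
    qed
    have "(\<Sum>i<N. f 1 (translate (int i * 1) n)) = (\<Sum>i\<in>{1..int N}. real (n i))" for N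
      unfolding f_def translate_apply n
      by (rule sum.reindex_bij_witness[of _ "\<lambda>i. nat (i - 1)" "\<lambda>i. int i + 1"]) (auto simp: add.commute)
    moreover have "(\<Sum>i<N. f (- 1) (translate (int i * - 1) n)) = (\<Sum>i\<in>{- int N..-1}. real (n i))" for N
      unfolding f_def translate_apply n
      by (rule sum.reindex_bij_witness[of _ "\<lambda>i. nat (- i - 1)" "\<lambda>i. - 1 - int i"]) auto
    ultimately show ?case
      using elim(2,3) by (simp add: density_at_def e)
  qed
  then show ?thesis
    unfolding has_density_iff by blast
qed

text \<open>The averages of the indicator of \<open>A\<close> tend to \<open>measure M A\<close>
  outside a set that is null for \<open>M\<close> and hence for \<open>N\<close>. Their integrals
  under the invariant \<open>N\<close> are all \<open>measure N A\<close>, so dominated convergence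
  equates the two numbers.\<close>

lemma ergodic_absolutely_continuous_eq:
  assumes M: "state M" "translation_invariant M" "ergodic M"
    and N: "state N" "translation_invariant N"
    and ac: "\<And>A. A \<in> sets borel \<Longrightarrow> measure M A = 0 \<Longrightarrow> measure N A = 0"
  shows "N = M"
proof (rule measure_eqI)
  show "sets N = sets M"
    by (simp add: stateD(2) M N)
  interpret M: prob_space M by (rule stateD(1)[OF M(1)])
  interpret N: prob_space N by (rule stateD(1)[OF N(1)])
  note [measurable_cong] = stateD(2)[OF N(1)]
  fix A assume "A \<in> sets N"
  then have A [measurable]: "A \<in> sets borel"
    by (simp add: stateD(2)[OF N(1)])
  let ?f = "indicator A :: config \<Rightarrow> real"
  let ?avg = "\<lambda>k n. (\<Sum>i<k. ?f (translate (int i) n)) / real k"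
  have m [measurable]: "(\<lambda>n. ?f (translate j n)) \<in> borel_measurable borel" for j
    by (rule measurable_compose[OF measurable_translate]) measurable
  have lim: "AE n in M. (\<lambda>k. ?avg k n) \<longlonglongrightarrow> measure M A"
    using birkhoff_translate[OF M disjI1[OF refl], of ?f 1] A
    by (simp add: stateD(2)[OF M(1)] stateD(3)[OF M(1)])
  have "AE n in N. (\<lambda>k. ?avg k n) \<longlonglongrightarrow> measure M A"
  proof -
    let ?B = "{n. \<not> (\<lambda>k. ?avg k n) \<longlonglongrightarrow> measure M A}"
    have "Measurable.pred borel (\<lambda>n. \<not> (\<lambda>k. ?avg k n) \<longlonglongrightarrow> measure M A)"
      unfolding LIMSEQ_countable by measurable
    then have B: "?B \<in> sets borel"
      by (simp add: pred_def)
    then have "measure M ?B = 0"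
      using lim by (subst M.prob_eq_0) (auto simp: stateD(2)[OF M(1)])
    then have "measure N ?B = 0"
      by (rule ac[OF B])
    then show ?thesis
      using B by (subst (asm) N.prob_eq_0) (auto simp: stateD(2)[OF N(1)])
  qed
  then have avg: "(\<lambda>k. \<integral>n. ?avg k n \<partial>N) \<longlonglongrightarrow> (\<integral>n. measure M A \<partial>N)"
  proof (rule integral_dominated_convergence[where w = "\<lambda>_. 1", rotated 3])
    show "AE n in N. norm (?avg k n) \<le> 1" for k
    proof (rule AE_I2)
      fix n
      have "(\<Sum>i<k. ?f (translate (int i) n)) \<le> real (card {..<k}) * 1"
        by (rule sum_bounded_above) (simp add: indicator_def)
      moreover have "0 \<le> (\<Sum>i<k. ?f (translate (int i) n))"
        by (rule sum_nonneg) simp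
      ultimately show "norm (?avg k n) \<le> 1"
        by (simp add: divide_le_eq)
    qed
  qed auto
  \<comment> \<open>The index starts at 1, as the average of no terms is 0.\<close>
  have "(\<integral>n. ?avg (Suc k) n \<partial>N) = measure N A" for k
  proof -
    have "(\<integral>n. ?f (translate j n) \<partial>N) = measure N A" for j
    proof -
      have "(\<integral>n. ?f (translate j n) \<partial>N) = (\<integral>n. ?f n \<partial>distr N borel (translate j))"
        by (rule integral_distr[symmetric]) measurable
      also have "\<dots> = measure N A"
        using N(2) A by (simp add: translation_invariant_def stateD(2,3)[OF N(1)])
      finally show ?thesis .
    qed
    moreover have "integrable N (\<lambda>n. ?f (translate j n))" for j
      by (rule N.integrable_const_bound[where B = 1]) auto
    ultimately show ?thesis
      by (simp add: Bochner_Integration.integral_sum del: sum.lessThan_Suc)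
  qed
  then have "(\<lambda>k. \<integral>n. ?avg (Suc k) n \<partial>N) \<longlonglongrightarrow> measure N A"
    by simp
  moreover from avg have "(\<lambda>k. \<integral>n. ?avg (Suc k) n \<partial>N) \<longlonglongrightarrow> (\<integral>n. measure M A \<partial>N)"
    by (rule LIMSEQ_Suc)
  ultimately have "measure N A = (\<integral>n. measure M A \<partial>N)"
    using LIMSEQ_unique by blast
  then have "measure N A = measure M A"
    by (simp add: N.prob_space)
  then show "emeasure N A = emeasure M A"
    by (simp add: N.emeasure_eq_measure M.emeasure_eq_measure)
qed

section \<open>Conservation of parities\<close>

definition parity :: "config \<Rightarrow> config" where
  "parity n = (\<lambda>i. n i mod 2)"

definition even_part :: "config \<Rightarrow> config" where
  "even_part n = (\<lambda>i. n i - n i mod 2)"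

lemma measurable_parity [measurable]: "parity \<in> borel \<rightarrow>\<^sub>M borel"
  unfolding parity_def by (rule measurable_config) (rule measurable_compose[OF measurable_site], simp)

lemma measurable_even_part [measurable]: "even_part \<in> borel \<rightarrow>\<^sub>M borel"
  unfolding even_part_def by (rule measurable_config) (rule measurable_compose[OF measurable_site], simp)

lemma \<gamma>_even_part_parity: "\<gamma> (even_part n) (parity n) = n"
  by (simp add: \<gamma>_def even_part_def parity_def)

lemma parity_in_S: "parity n \<in> S"
  by (auto simp: parity_def S_def)

text \<open>Heights 0 and 1 have even part 0, all others at least 2. The even part therefore shows
  the same short stacks, and with the same coins the same fluxes.\<close>

lemma short_even_part: "short (even_part n i) \<longleftrightarrow> short (n i)"
  unfolding short_def even_part_def by presburger

lemma flux_even_part: "flux (even_part n) c k = flux n c k"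
  by (simp add: flux_def short_even_part)

lemma even_part_Xstar: "n \<in> Xstar \<Longrightarrow> even_part n \<in> Xstar_even"
  unfolding Xstar_even_def Xstar_def mem_Collect_eq short_even_part
  by (simp add: even_part_def minus_mod_eq_mult_div)

lemma even_part_int: "int (even_part n i) = int (n i) - int (parity n i)"
  by (simp add: even_part_def parity_def of_nat_diff)

lemma parity_step:
  assumes "n \<in> Xstar"
  shows "parity (ssm_step n c) = parity n"
proof
  fix k
  have "odd (flux n c i)" for i
    using assms by (auto simp: Xstar_def flux_def)
  then have "even (flux n c (k - 1) - flux n c k)"
    by simp
  then have "int (ssm_step n c k) mod 2 = int (n k) mod 2"
    unfolding step_int by presburger
  then show "parity (ssm_step n c) k = parity n k"
    unfolding parity_def by presburger
qed

lemma even_part_step: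
  assumes "n \<in> Xstar"
  shows "ssm_step (even_part n) c = even_part (ssm_step n c)"
proof
  fix k
  have "int (ssm_step (even_part n) c k) = int (even_part (ssm_step n c) k)"
    unfolding even_part_int parity_step[OF assms] step_int flux_even_part by simp
  then show "ssm_step (even_part n) c k = even_part (ssm_step n c) k"
    by simp
qed

lemma \<gamma>_decompose:
  assumes "m \<in> Xstar_even" "\<sigma> \<in> S"
  shows "parity (\<gamma> m \<sigma>) = \<sigma>" "even_part (\<gamma> m \<sigma>) = m" "\<gamma> m \<sigma> \<in> Xstar"
proof -
  have s: "\<sigma> i = 0 \<or> \<sigma> i = 1" and m: "even (m i)" for i
    using assms by (auto simp: S_def Xstar_even_def)
  show p: "parity (\<gamma> m \<sigma>) = \<sigma>"
  proof
    show "parity (\<gamma> m \<sigma>) i = \<sigma> i" for i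
      using s[of i] m[of i] by (auto simp: parity_def \<gamma>_def)
  qed
  have "\<gamma> m \<sigma> i mod 2 = \<sigma> i" for i
    using fun_cong[OF p, of i] by (simp add: parity_def)
  then show e: "even_part (\<gamma> m \<sigma>) = m"
    by (simp add: even_part_def) (simp add: \<gamma>_def)
  show "\<gamma> m \<sigma> \<in> Xstar"
    using assms(1) short_even_part[of "\<gamma> m \<sigma>"] by (simp add: Xstar_even_def Xstar_def e)
qed

lemma \<gamma>_step:
  assumes "m \<in> Xstar_even" "\<sigma> \<in> S"
  shows "ssm_step (\<gamma> m \<sigma>) c = \<gamma> (ssm_step m c) \<sigma>"
  using \<gamma>_even_part_parity[of "ssm_step (\<gamma> m \<sigma>) c"] \<gamma>_decompose[OF assms]
    even_part_step[of "\<gamma> m \<sigma>" c] parity_step[of "\<gamma> m \<sigma>" c]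
  by simp

lemma measurable_Xstar_even [measurable]: "Measurable.pred borel (\<lambda>n. n \<in> Xstar_even)"
proof -
  have [measurable]: "Measurable.pred borel (\<lambda>n::config. even (n i))" for i
    by (rule measurable_compose[OF measurable_site]) simp
  show ?thesis
    unfolding Xstar_even_def Xstar_def by (simp, measurable)
qed

lemma measurable_S [measurable]: "Measurable.pred borel (\<lambda>n. n \<in> S)"
proof -
  have [measurable]: "Measurable.pred borel (\<lambda>n::config. n i \<in> {0, 1})" for i
    by (rule measurable_compose[OF measurable_site]) simp
  show ?thesis
    unfolding S_def by (simp only: mem_Collect_eq, measurable)
qed

section \<open>Densities of sums, even parts and translates\<close>

lemma density_at_sum:
  assumes "density_at a m" "density_at b \<sigma>"
  shows "density_at (a + b) (\<gamma> m \<sigma>)"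
  using assms unfolding density_at_def \<gamma>_def of_nat_add sum.distrib add_divide_distrib
  by (auto intro: tendsto_add)

lemma density_at_even_part:
  assumes "density_at a n" "density_at b (parity n)"
  shows "density_at (a - b) (even_part n)"
proof -
  have "real (even_part n i) = real (n i) - real (parity n i)" for i
    by (simp add: even_part_def parity_def of_nat_diff)
  then show ?thesis
    using assms unfolding density_at_def by (auto simp: sum_subtractf diff_divide_distrib intro!: tendsto_diff)
qed

text \<open>One of any two neighbours is tall, so each adjacent pair carries at least 2 particles.
  Counting by pairs bounds the averages of even length, and these form a subsequence.\<close>

lemma density_ge_1:
  assumes n: "m \<in> Xstar_even" and d: "density_at r m"
  shows "1 \<le> r"
proof -
  let ?avg = "\<lambda>N. (\<Sum>i\<in>{1..int N}. real (m i)) / real N"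
  have pair: "2 \<le> m i + m (i + 1)" for i
    using n by (auto simp: Xstar_even_def Xstar_def short_def) (metis One_nat_def add_leE not_less_eq_eq numeral_2_eq_2 trans_le_add1 trans_le_add2)
  have s: "2 * real N \<le> (\<Sum>i\<in>{1..int (2 * N)}. real (m i))" for N
  proof (induction N)
    case (Suc N)
    have "{1..int (2 * Suc N)} = insert (2 * int N + 2) (insert (2 * int N + 1) {1..int (2 * N)})"
      by auto
    then have "(\<Sum>i\<in>{1..int (2 * Suc N)}. real (m i)) =
      real (m (2 * int N + 2)) + (real (m (2 * int N + 1)) + (\<Sum>i\<in>{1..int (2 * N)}. real (m i)))"
      by simp
    moreover have "2 \<le> real (m (2 * int N + 1)) + real (m (2 * int N + 2))"
      using pair[of "2 * int N + 1"] by (simp add: add.assoc)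
    ultimately show ?case
      using Suc by simp
  qed simp
  have "?avg \<longlonglongrightarrow> r"
    using d by (simp add: density_at_def)
  then have "(?avg \<circ> (\<lambda>N. 2 * N)) \<longlonglongrightarrow> r"
    by (rule LIMSEQ_subseq_LIMSEQ) (simp add: strict_mono_def)
  moreover have "\<forall>N\<ge>1. 1 \<le> (?avg \<circ> (\<lambda>N. 2 * N)) N"
    using s by (simp add: le_divide_eq)
  ultimately show ?thesis
    by (rule LIMSEQ_le_const[OF _ exI])
qed

text \<open>A translation by one site changes a one-sided sum by a boundary term \<open>b\<close>
  and shifts its length by one. The first form is for the sums to the right, the second for those to
  the left.\<close>

lemma average_shift:
  fixes a :: "nat \<Rightarrow> real"
  assumes "(\<lambda>N. a N / real N) \<longlonglongrightarrow> r"
  shows "(\<lambda>N. (a (Suc N) + b) / real N) \<longlonglongrightarrow> r" "(\<lambda>N. (a N + b) / real (Suc N)) \<longlonglongrightarrow> r"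
proof -
  have "(\<lambda>N. a (Suc N) / real (Suc N) * (real (Suc N) / real N) + b / real N) \<longlonglongrightarrow> r * 1 + 0"
    by (intro tendsto_add tendsto_mult LIMSEQ_Suc[OF assms] LIMSEQ_Suc_n_over_n lim_const_over_n)
  moreover have "a (Suc N) / real (Suc N) * (real (Suc N) / real N) + b / real N = (a (Suc N) + b) / real N" for N
    by (simp add: add_divide_distrib del: of_nat_Suc)
  ultimately show "(\<lambda>N. (a (Suc N) + b) / real N) \<longlonglongrightarrow> r"
    by simp
  have "(\<lambda>N. a N / real N * (real N / real (Suc N)) + b / real (Suc N)) \<longlonglongrightarrow> r * 1 + 0"
    by (intro tendsto_add tendsto_mult assms LIMSEQ_n_over_Suc_n LIMSEQ_Suc[OF lim_const_over_n])
  moreover have "eventually (\<lambda>N. a N / real N * (real N / real (Suc N)) + b / real (Suc N) = (a N + b) / real (Suc N)) sequentially"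
    using eventually_gt_at_top[of 0] by eventually_elim (simp add: add_divide_distrib del: of_nat_Suc)
  ultimately show "(\<lambda>N. (a N + b) / real (Suc N)) \<longlonglongrightarrow> r"
    using tendsto_cong by force
qed

lemma density_at_shift:
  assumes "density_at r n"
  shows "density_at r (translate 1 n)"
proof -
  have right: "(\<Sum>i\<in>{1..int N}. real (n (i + 1))) = (\<Sum>i\<in>{1..int (Suc N)}. real (n i)) + - real (n 1)" for N
  proof -
    have "{1..int (Suc N)} = insert 1 {2..int (Suc N)}"
      by auto
    moreover have "(\<Sum>i\<in>{1..int N}. real (n (i + 1))) = (\<Sum>i\<in>{2..int (Suc N)}. real (n i))"
      by (rule sum.reindex_bij_witness[of _ "\<lambda>i. i - 1" "\<lambda>i. i + 1"]) auto
    ultimately show ?thesis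
      by simp
  qed
  have left: "(\<Sum>i\<in>{- int (Suc N)..-1}. real (n (i + 1))) = (\<Sum>i\<in>{- int N..-1}. real (n i)) + real (n 0)" for N
  proof -
    have "{- int N..0} = insert 0 {- int N..-1}"
      by auto
    moreover have "(\<Sum>i\<in>{- int (Suc N)..-1}. real (n (i + 1))) = (\<Sum>i\<in>{- int N..0}. real (n i))"
      by (rule sum.reindex_bij_witness[of _ "\<lambda>i. i - 1" "\<lambda>i. i + 1"]) auto
    ultimately show ?thesis
      by simp
  qed
  have "(\<lambda>N. (\<Sum>i\<in>{1..int N}. real (n (i + 1))) / real N) \<longlonglongrightarrow> r"
    unfolding right using assms by (intro average_shift) (simp add: density_at_def)
  moreover have "(\<lambda>N. (\<Sum>i\<in>{- int N..-1}. real (n (i + 1))) / real N) \<longlonglongrightarrow> r"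
    by (rule LIMSEQ_imp_Suc, unfold left) (use assms in \<open>intro average_shift, simp add: density_at_def\<close>)
  ultimately show ?thesis
    unfolding density_at_def translate_apply by blast
qed

lemma density_at_translate:
  assumes "density_at r n"
  shows "density_at r (translate k n)"
proof -
  have pos: "density_at r (translate (int j) n)" if "density_at r n" for j n
  proof (induction j)
    case (Suc j)
    from density_at_shift[OF this] show ?case
      by (simp add: translate_translate)
  qed (use that in simp)
  show ?thesis
  proof (cases "0 \<le> k")
    case True
    then show ?thesis
      using pos[OF assms, of "nat k"] by simp
  next
    case False
    have "translate k n = reflect (translate (- k) (reflect n))"
      by (simp add: translate_def reflect_def fun_eq_iff add.commute)
    then show ?thesis
      using pos[of "reflect n" "nat (- k)"] assms False by (simp add: density_at_reflect)
  qed
qed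

lemma translate_Xstar_even: "n \<in> Xstar_even \<Longrightarrow> translate k n \<in> Xstar_even"
  by (auto simp: Xstar_even_def Xstar_def translate_apply algebra_simps)

lemma translate_\<gamma>: "translate k (\<gamma> m \<sigma>) = \<gamma> (translate k m) (translate k \<sigma>)"
  by (simp add: translate_def \<gamma>_def)

lemma translate_parity: "translate k (parity n) = parity (translate k n)"
  by (simp add: translate_def parity_def)

section \<open>Independence of even part and parity\<close>

lemma state_on_distr:
  assumes "state M" "f \<in> borel \<rightarrow>\<^sub>M borel" "Measurable.pred borel (\<lambda>n. n \<in> A)" "AE n in M. f n \<in> A"
  shows "state_on A (distr M borel f)"
  using assms AE_distr_config[OF assms(1-3)] state_distr[OF stateD(1)[OF assms(1)]]
  by (simp add: state_on_def measurable_cong_sets[OF stateD(2)[OF assms(1)] refl])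

lemma has_density_distr:
  assumes "state M" "f \<in> borel \<rightarrow>\<^sub>M borel" "AE n in M. density_at r (f n)"
  shows "has_density (distr M borel f) r"
  unfolding has_density_iff AE_distr_config[OF assms(1,2) measurable_density_at] by (rule assms(3))

lemma translation_invariant_distr:
  assumes M: "state M" "translation_invariant M" and f: "f \<in> borel \<rightarrow>\<^sub>M borel"
    and comm: "\<And>k n. translate k (f n) = f (translate k n)"
  shows "translation_invariant (distr M borel f)"
  unfolding translation_invariant_def
proof
  fix k
  have m: "f \<in> M \<rightarrow>\<^sub>M borel" "translate k \<in> M \<rightarrow>\<^sub>M borel"
    using f by (simp_all add: measurable_cong_sets[OF stateD(2)[OF M(1)] refl])
  have "distr (distr M borel f) borel (translate k) = distr (distr M borel (translate k)) borel f"
    using m f by (simp add: distr_distr comp_def comm)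
  then show "distr (distr M borel f) borel (translate k) = distr M borel f"
    using M(2) by (simp add: translation_invariant_def)
qed

lemma AE_parity_even_part:
  assumes "state M" "AE n in M. n \<in> Xstar" "has_density M \<rho>" "has_density (distr M borel parity) \<kappa>"
  shows "AE n in M. even_part n \<in> Xstar_even \<and> density_at (\<rho> - \<kappa>) (even_part n)"
proof -
  have "AE n in M. density_at \<kappa> (parity n)"
    using assms(4) AE_distr_config[OF assms(1) measurable_parity measurable_density_at]
    by (simp add: has_density_iff)
  with assms(2,3) show ?thesis
    unfolding has_density_iff by eventually_elim (simp add: even_part_Xstar density_at_even_part)
qed

lemma stationary_even_part:
  assumes M: "state M" "stationary M" "AE n in M. n \<in> Xstar"
  shows "stationary (distr M borel even_part)"
proof (rule stationary_distr[OF M(1,2) measurable_even_part])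
  show "(\<lambda>c. c) \<in> coins \<rightarrow>\<^sub>M coins" "distr coins coins (\<lambda>c. c) = coins"
    by (simp_all add: distr_id2)
  show "AE n in M. \<forall>c. ssm_step (even_part n) c = even_part (ssm_step n c)"
    using M(3) by eventually_elim (simp add: even_part_step)
qed

text \<open>Since parities are frozen, conditioning on them keeps the even part stationary, so the
  uniqueness hypothesis makes it independent of the parities.\<close>

lemma stationary_state_factorizes:
  assumes unique: "\<And>N. state_on Xstar_even N \<Longrightarrow> stationary N \<Longrightarrow> has_density N (\<rho> - \<kappa>) \<Longrightarrow> N = \<mu>"
    and M: "state M" "stationary M" "AE n in M. n \<in> Xstar"
    and d: "has_density M \<rho>" "has_density (distr M borel parity) \<kappa>"
  shows "M = \<gamma>_push \<mu> (distr M borel parity)"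
proof -
  let ?L = "distr M borel parity"
  interpret M: prob_space M by (rule stateD(1)[OF M(1)])
  note [measurable_cong] = stateD(2)[OF M(1)]
  have parM: "parity \<in> M \<rightarrow>\<^sub>M borel" and evM: "even_part \<in> M \<rightarrow>\<^sub>M borel"
    by measurable
  interpret L: prob_space ?L by (rule M.prob_space_distr[OF parM])
  have cond: "distr (uniform_measure M (parity -` A)) borel even_part = \<mu>"
    if A: "A \<in> sets borel" and pos: "emeasure M (parity -` A) \<noteq> 0" for A
  proof -
    let ?C = "parity -` A" and ?N = "uniform_measure M (parity -` A)"
    have C: "?C \<in> sets borel"
      using measurable_sets[OF measurable_parity A] by simp
    have N: "state ?N"
      by (rule state_uniform[OF M(1) pos])
    have AE_N: "AE n in ?N. Q n" if "AE n in M. Q n" for Q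
      by (rule AE_uniform_measureI) (use C that stateD(2)[OF M(1)] in \<open>auto elim!: eventually_mono\<close>)
    have st: "stationary ?N"
    proof (rule stationary_uniform[OF M(1,2) C])
      show "AE n in M. \<forall>c. ssm_step n c \<in> ?C \<longleftrightarrow> n \<in> ?C"
        using M(3) by eventually_elim (simp add: parity_step)
    qed
    have e: "AE n in ?N. even_part n \<in> Xstar_even \<and> density_at (\<rho> - \<kappa>) (even_part n)"
      by (rule AE_N[OF AE_parity_even_part[OF M(1,3) d]])
    show ?thesis
    proof (rule unique)
      show "state_on Xstar_even (distr ?N borel even_part)"
        using e by (intro state_on_distr N measurable_even_part measurable_Xstar_even) auto
      show "stationary (distr ?N borel even_part)"
        by (rule stationary_even_part[OF N st AE_N[OF M(3)]])
      show "has_density (distr ?N borel even_part) (\<rho> - \<kappa>)"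
        using e by (intro has_density_distr N measurable_even_part) auto
    qed
  qed
  \<comment> \<open>Conditioning on the sure event identifies \<open>\<mu>\<close> with the law of
    the even part, which makes it a probability measure on the Borel sets.\<close>
  have "distr (uniform_measure M (parity -` UNIV)) borel even_part = \<mu>"
    by (rule cond) (use M.emeasure_space_1 stateD(3)[OF M(1)] in auto)
  then have mu: "prob_space \<mu>" and sets_mu: "sets \<mu> = sets borel"
    using state_distr[OF stateD(1)[OF state_uniform[OF M(1)], of "UNIV"], of even_part]
      M.emeasure_space_1 stateD(3)[OF M(1)] evM
    by (auto simp: state_def)
  interpret mu: prob_space \<mu> by (rule mu)
  \<comment> \<open>On rectangles this is the product rule: given any parity event of positive
    probability, the even part has the same law \<open>\<mu>\<close>.\<close>
  have prod: "\<mu> \<Otimes>\<^sub>M ?L = distr M (borel \<Otimes>\<^sub>M borel) (\<lambda>n. (even_part n, parity n))"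
  proof (rule pair_measure_eqI)
    show "sigma_finite_measure \<mu>" "sigma_finite_measure ?L"
      by unfold_locales
    show "sets (\<mu> \<Otimes>\<^sub>M ?L) = sets (distr M (borel \<Otimes>\<^sub>M borel) (\<lambda>n. (even_part n, parity n)))"
      by (simp add: sets_mu cong: sets_pair_measure_cong)
    fix B A assume "B \<in> sets \<mu>" "A \<in> sets ?L"
    then have B [measurable]: "B \<in> sets borel" and A [measurable]: "A \<in> sets borel"
      by (simp_all add: sets_mu)
    have C: "parity -` A \<in> sets M" and D: "even_part -` B \<in> sets M"
      using measurable_sets[OF measurable_parity A] measurable_sets[OF measurable_even_part B]
      by (simp_all add: stateD(2)[OF M(1)])
    have "emeasure (distr M (borel \<Otimes>\<^sub>M borel) (\<lambda>n. (even_part n, parity n))) (B \<times> A) =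
      emeasure M ((\<lambda>n. (even_part n, parity n)) -` (B \<times> A) \<inter> space M)"
      by (rule emeasure_distr) measurable
    also have "(\<lambda>n. (even_part n, parity n)) -` (B \<times> A) \<inter> space M = parity -` A \<inter> even_part -` B"
      by (auto simp: stateD(3)[OF M(1)])
    finally have r: "emeasure (distr M (borel \<Otimes>\<^sub>M borel) (\<lambda>n. (even_part n, parity n))) (B \<times> A) =
      emeasure M (parity -` A \<inter> even_part -` B)" .
    have l: "emeasure ?L A = emeasure M (parity -` A)"
      using emeasure_distr[OF parM A] by (simp add: stateD(3)[OF M(1)])
    show "emeasure \<mu> B * emeasure ?L A =
      emeasure (distr M (borel \<Otimes>\<^sub>M borel) (\<lambda>n. (even_part n, parity n))) (B \<times> A)"
    proof (cases "emeasure M (parity -` A) = 0")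
      case True
      have "emeasure M (parity -` A \<inter> even_part -` B) \<le> emeasure M (parity -` A)"
        by (rule emeasure_mono) (use C in auto)
      then show ?thesis
        using True unfolding l r by simp
    next
      case False
      have "emeasure \<mu> B = emeasure (uniform_measure M (parity -` A)) (even_part -` B)"
        using emeasure_distr[of even_part "uniform_measure M (parity -` A)" borel B] evM B cond[OF A False]
        by (simp add: stateD(3)[OF M(1)])
      also have "\<dots> = emeasure M (parity -` A \<inter> even_part -` B) / emeasure M (parity -` A)"
        by (rule emeasure_uniform_measure[OF C D])
      finally show ?thesis
        unfolding l r using False M.emeasure_finite
        by (metis ennreal_times_divide infinity_ennreal_def mult.commute mult_divide_eq_ennreal)
    qed
  qed
  have "\<gamma>_push \<mu> ?L = distr M borel (\<lambda>n. \<gamma> (even_part n) (parity n))"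
    unfolding \<gamma>_push_def prod by (subst distr_distr) (auto simp: comp_def)
  also have "\<dots> = M"
    unfolding \<gamma>_even_part_parity by (rule distr_id2) (simp add: stateD(2)[OF M(1)])
  finally show ?thesis ..
qed

lemma density_bound:
  assumes "state M" "AE n in M. n \<in> Xstar" "has_density M \<rho>" "has_density (distr M borel parity) \<kappa>"
  shows "\<kappa> \<le> \<rho> - 1"
proof -
  interpret prob_space M by (rule stateD(1)[OF assms(1)])
  have "AE n in M. 1 \<le> \<rho> - \<kappa>"
    using AE_parity_even_part[OF assms] by eventually_elim (auto dest: density_ge_1)
  then show ?thesis
    by simp
qed

section \<open>Independent superposition of an even state and a parity law\<close>

lemma nn_integral_ssm_evolve:
  assumes M: "state M" and h [measurable]: "h \<in> borel_measurable borel"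
  shows "(\<integral>\<^sup>+n. h n \<partial>ssm_evolve M) = (\<integral>\<^sup>+n. \<integral>\<^sup>+c. h (ssm_step n c) \<partial>coins \<partial>M)"
proof -
  interpret coins: prob_space coins by (rule prob_space_coins)
  have s: "(\<lambda>(n, c). ssm_step n c) \<in> M \<Otimes>\<^sub>M coins \<rightarrow>\<^sub>M borel"
    by (rule measurable_step_state[OF stateD(2)[OF M]])
  have "(\<integral>\<^sup>+n. h n \<partial>ssm_evolve M) = (\<integral>\<^sup>+x. h ((\<lambda>(n, c). ssm_step n c) x) \<partial>(M \<Otimes>\<^sub>M coins))"
    unfolding ssm_evolve_def using s by (rule nn_integral_distr) measurable
  also have "\<dots> = (\<integral>\<^sup>+n. \<integral>\<^sup>+c. h ((\<lambda>(n, c). ssm_step n c) (n, c)) \<partial>coins \<partial>M)"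
    by (rule coins.nn_integral_fst[symmetric]) (rule measurable_compose[OF s h])
  finally show ?thesis
    by simp
qed

lemma measurable_\<gamma>_state:
  assumes "sets M = sets borel" "sets N = sets borel"
  shows "(\<lambda>(m, \<sigma>). \<gamma> m \<sigma>) \<in> M \<Otimes>\<^sub>M N \<rightarrow>\<^sub>M borel"
  using measurable_\<gamma> by (simp add: measurable_cong_sets[OF sets_pair_measure_cong[OF assms] refl])

lemma measurable_\<gamma>_compose:
  assumes "f \<in> K \<rightarrow>\<^sub>M borel" "g \<in> K \<rightarrow>\<^sub>M borel"
  shows "(\<lambda>x. \<gamma> (f x) (g x)) \<in> K \<rightarrow>\<^sub>M borel"
  using measurable_compose[OF measurable_Pair[OF assms] measurable_\<gamma>] by simp

lemma measurable_step_compose: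
  assumes "f \<in> K \<rightarrow>\<^sub>M borel" "g \<in> K \<rightarrow>\<^sub>M coins"
  shows "(\<lambda>x. ssm_step (f x) (g x)) \<in> K \<rightarrow>\<^sub>M borel"
  using measurable_compose[OF measurable_Pair[OF assms] measurable_ssm_step] by simp

lemma measurable_nn_integral_\<gamma>:
  assumes N: "state N" and h: "h \<in> borel_measurable borel"
  shows "(\<lambda>m. \<integral>\<^sup>+\<sigma>. h (\<gamma> m \<sigma>) \<partial>N) \<in> borel_measurable borel"
proof -
  interpret N: prob_space N by (rule stateD(1)[OF N])
  note [measurable_cong] = stateD(2)[OF N]
  show ?thesis
    by (rule N.borel_measurable_nn_integral)
      (simp add: case_prod_unfold, intro measurable_compose[OF measurable_\<gamma>_compose h], measurable)
qed

lemma nn_integral_\<gamma>_push: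
  assumes M: "state M" "state N" and h [measurable]: "h \<in> borel_measurable borel"
  shows "(\<integral>\<^sup>+n. h n \<partial>\<gamma>_push M N) = (\<integral>\<^sup>+m. \<integral>\<^sup>+\<sigma>. h (\<gamma> m \<sigma>) \<partial>N \<partial>M)"
proof -
  interpret N: prob_space N by (rule stateD(1)[OF M(2)])
  have s: "(\<lambda>(m, \<sigma>). \<gamma> m \<sigma>) \<in> M \<Otimes>\<^sub>M N \<rightarrow>\<^sub>M borel"
    by (rule measurable_\<gamma>_state) (simp_all add: stateD(2) M)
  have "(\<integral>\<^sup>+n. h n \<partial>\<gamma>_push M N) = (\<integral>\<^sup>+x. h ((\<lambda>(m, \<sigma>). \<gamma> m \<sigma>) x) \<partial>(M \<Otimes>\<^sub>M N))"
    unfolding \<gamma>_push_def using s by (rule nn_integral_distr) measurable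
  also have "\<dots> = (\<integral>\<^sup>+m. \<integral>\<^sup>+\<sigma>. h ((\<lambda>(m, \<sigma>). \<gamma> m \<sigma>) (m, \<sigma>)) \<partial>N \<partial>M)"
    by (rule N.nn_integral_fst[symmetric]) (rule measurable_compose[OF s h])
  finally show ?thesis
    by simp
qed

lemma state_\<gamma>_push:
  assumes "state M" "state N"
  shows "state (\<gamma>_push M N)"
proof -
  interpret M: prob_space M by (rule stateD(1)[OF assms(1)])
  interpret N: prob_space N by (rule stateD(1)[OF assms(2)])
  interpret pair_prob_space M N ..
  show ?thesis
    unfolding \<gamma>_push_def
    by (rule state_distr[OF prob_space_axioms measurable_\<gamma>_state]) (simp_all add: stateD(2) assms)
qed

lemma state_eqI:
  assumes "state M" "state N"
    and "\<And>h :: config \<Rightarrow> ennreal. h \<in> borel_measurable borel \<Longrightarrow> (\<integral>\<^sup>+n. h n \<partial>M) = (\<integral>\<^sup>+n. h n \<partial>N)"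
  shows "M = N"
proof (rule measure_eqI)
  fix A assume "A \<in> sets M"
  then show "emeasure M A = emeasure N A"
    using assms(3)[of "indicator A"] by (simp add: stateD(2) assms(1,2))
qed (simp add: stateD(2) assms)

lemma state_ssm_evolve:
  assumes "state M"
  shows "state (ssm_evolve M)"
proof -
  interpret M: prob_space M by (rule stateD(1)[OF assms(1)])
  interpret coins: prob_space coins by (rule prob_space_coins)
  interpret pair_prob_space M coins ..
  show ?thesis
    unfolding ssm_evolve_def
    by (rule state_distr[OF prob_space_axioms measurable_step_state]) (simp add: stateD(2) assms)
qed

text \<open>A step acts on the even part alone and leaves \<sigma> fixed. Integrating out \<sigma>
  before the coins, by Fubini, turns the claim for \<open>h\<close> into stationarity of
  \<open>M\<close> for the test function \<open>g\<close>.\<close>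

lemma stationary_\<gamma>_push:
  assumes M: "state_on Xstar_even M" "stationary M" and N: "state_on S N"
  shows "stationary (\<gamma>_push M N)"
proof -
  have sM: "state M" "AE m in M. m \<in> Xstar_even" and sN: "state N" "AE \<sigma> in N. \<sigma> \<in> S"
    using M(1) N by (auto simp: state_on_def)
  interpret N: prob_space N by (rule stateD(1)[OF sN(1)])
  interpret coins: prob_space coins by (rule prob_space_coins)
  interpret pair_sigma_finite N coins ..
  note [measurable_cong] = stateD(2)[OF sM(1)] stateD(2)[OF sN(1)]
  have "ssm_evolve (\<gamma>_push M N) = \<gamma>_push M N"
  proof (rule state_eqI)
    fix h :: "config \<Rightarrow> ennreal"
    assume h [measurable]: "h \<in> borel_measurable borel"
    define g where "g m = (\<integral>\<^sup>+\<sigma>. h (\<gamma> m \<sigma>) \<partial>N)" for m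
    have g: "g \<in> borel_measurable borel"
      unfolding g_def by (rule measurable_nn_integral_\<gamma>[OF sN(1) h])
    have m1: "(\<lambda>n. \<integral>\<^sup>+c. h (ssm_step n c) \<partial>coins) \<in> borel_measurable borel"
      using measurable_compose[OF measurable_ssm_step h]
      by (intro coins.borel_measurable_nn_integral) (simp add: case_prod_unfold)
    have "(\<integral>\<^sup>+n. h n \<partial>ssm_evolve (\<gamma>_push M N)) =
      (\<integral>\<^sup>+m. \<integral>\<^sup>+\<sigma>. \<integral>\<^sup>+c. h (ssm_step (\<gamma> m \<sigma>) c) \<partial>coins \<partial>N \<partial>M)"
      by (subst nn_integral_ssm_evolve[OF state_\<gamma>_push[OF sM(1) sN(1)] h])
        (rule nn_integral_\<gamma>_push[OF sM(1) sN(1) m1])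
    also have "\<dots> = (\<integral>\<^sup>+m. \<integral>\<^sup>+c. g (ssm_step m c) \<partial>coins \<partial>M)"
    proof (rule nn_integral_cong_AE)
      show "AE m in M. (\<integral>\<^sup>+\<sigma>. \<integral>\<^sup>+c. h (ssm_step (\<gamma> m \<sigma>) c) \<partial>coins \<partial>N) = (\<integral>\<^sup>+c. g (ssm_step m c) \<partial>coins)"
        using sM(2)
      proof eventually_elim
        case (elim m)
        have "(\<integral>\<^sup>+\<sigma>. \<integral>\<^sup>+c. h (ssm_step (\<gamma> m \<sigma>) c) \<partial>coins \<partial>N) =
          (\<integral>\<^sup>+\<sigma>. \<integral>\<^sup>+c. h (\<gamma> (ssm_step m c) \<sigma>) \<partial>coins \<partial>N)"
          using sN(2) by (intro nn_integral_cong_AE) (auto elim!: eventually_mono simp: \<gamma>_step[OF elim])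
        also have "\<dots> = (\<integral>\<^sup>+c. \<integral>\<^sup>+\<sigma>. h (\<gamma> (ssm_step m c) \<sigma>) \<partial>N \<partial>coins)"
        proof (rule Fubini'[symmetric])
          have "(\<lambda>x. ssm_step m (snd x)) \<in> N \<Otimes>\<^sub>M coins \<rightarrow>\<^sub>M borel"
            by (intro measurable_step_compose measurable_const measurable_snd) simp
          moreover have "fst \<in> N \<Otimes>\<^sub>M coins \<rightarrow>\<^sub>M borel"
            using measurable_fst[of N coins] by (simp add: measurable_cong_sets[OF refl stateD(2)[OF sN(1)]])
          ultimately show "(\<lambda>(\<sigma>, c). h (\<gamma> (ssm_step m c) \<sigma>)) \<in> borel_measurable (N \<Otimes>\<^sub>M coins)"
            using measurable_compose[OF measurable_\<gamma>_compose h] by (simp add: case_prod_unfold)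
        qed
        finally show ?case
          by (simp add: g_def)
      qed
    qed
    also have "\<dots> = (\<integral>\<^sup>+m. g m \<partial>ssm_evolve M)"
      by (rule nn_integral_ssm_evolve[OF sM(1) g, symmetric])
    also have "\<dots> = (\<integral>\<^sup>+m. g m \<partial>M)"
      using M(2) by (simp add: stationary_def)
    also have "\<dots> = (\<integral>\<^sup>+n. h n \<partial>\<gamma>_push M N)"
      unfolding g_def by (rule nn_integral_\<gamma>_push[OF sM(1) sN(1) h, symmetric])
    finally show "(\<integral>\<^sup>+n. h n \<partial>ssm_evolve (\<gamma>_push M N)) = (\<integral>\<^sup>+n. h n \<partial>\<gamma>_push M N)" .
  qed (intro state_ssm_evolve state_\<gamma>_push sM sN)+
  then show ?thesis
    by (simp add: stationary_def)
qed

lemma nn_integral_distr_config: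
  assumes "state M" "f \<in> borel \<rightarrow>\<^sub>M borel" "h \<in> borel_measurable borel"
  shows "(\<integral>\<^sup>+n. h n \<partial>distr M borel f) = (\<integral>\<^sup>+n. h (f n) \<partial>M)"
  using assms by (intro nn_integral_distr) (simp_all add: measurable_cong_sets[OF stateD(2)[OF assms(1)] refl])

lemma translation_invariant_\<gamma>_push:
  assumes M: "state M" "translation_invariant M" and N: "state N" "translation_invariant N"
  shows "translation_invariant (\<gamma>_push M N)"
  unfolding translation_invariant_def
proof
  fix k
  let ?T = "translate k"
  have st: "state (distr (\<gamma>_push M N) borel ?T)"
    using state_distr[OF stateD(1)[OF state_\<gamma>_push[OF M(1) N(1)]], of ?T]
    by (simp add: measurable_cong_sets[OF stateD(2)[OF state_\<gamma>_push[OF M(1) N(1)]] refl])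
  show "distr (\<gamma>_push M N) borel ?T = \<gamma>_push M N"
  proof (rule state_eqI[OF st state_\<gamma>_push[OF M(1) N(1)]])
    fix h :: "config \<Rightarrow> ennreal"
    assume h [measurable]: "h \<in> borel_measurable borel"
    have hT: "(\<lambda>n. h (?T n)) \<in> borel_measurable borel"
      by (rule measurable_compose[OF measurable_translate h])
    have \<gamma>1: "(\<lambda>\<sigma>. h (\<gamma> m \<sigma>)) \<in> borel_measurable borel" for m
      by (intro measurable_compose[OF measurable_\<gamma>_compose h]) measurable
    note g = measurable_nn_integral_\<gamma>[OF N(1) h]
    have "(\<integral>\<^sup>+n. h n \<partial>distr (\<gamma>_push M N) borel ?T) = (\<integral>\<^sup>+n. h (?T n) \<partial>\<gamma>_push M N)"
      by (rule nn_integral_distr_config[OF state_\<gamma>_push[OF M(1) N(1)] measurable_translate h])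
    also have "\<dots> = (\<integral>\<^sup>+m. \<integral>\<^sup>+\<sigma>. h (\<gamma> (?T m) (?T \<sigma>)) \<partial>N \<partial>M)"
      unfolding nn_integral_\<gamma>_push[OF M(1) N(1) hT] translate_\<gamma> ..
    also have "\<dots> = (\<integral>\<^sup>+m. \<integral>\<^sup>+\<sigma>. h (\<gamma> (?T m) \<sigma>) \<partial>distr N borel ?T \<partial>M)"
      unfolding nn_integral_distr_config[OF N(1) measurable_translate \<gamma>1] ..
    also have "\<dots> = (\<integral>\<^sup>+m. \<integral>\<^sup>+\<sigma>. h (\<gamma> m \<sigma>) \<partial>N \<partial>distr M borel ?T)"
      using N(2) unfolding nn_integral_distr_config[OF M(1) measurable_translate g]
      by (simp add: translation_invariant_def)
    also have "\<dots> = (\<integral>\<^sup>+n. h n \<partial>\<gamma>_push M N)"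
      using M(2) unfolding nn_integral_\<gamma>_push[OF M(1) N(1) h] by (simp add: translation_invariant_def)
    finally show "(\<integral>\<^sup>+n. h n \<partial>distr (\<gamma>_push M N) borel ?T) = (\<integral>\<^sup>+n. h n \<partial>\<gamma>_push M N)" .
  qed
qed

lemma AE_\<gamma>_push:
  assumes M: "state M" "state N" and P: "Measurable.pred borel P"
    and AE: "AE m in M. Q m" "AE \<sigma> in N. R \<sigma>"
    and QR: "\<And>m \<sigma>. Q m \<Longrightarrow> R \<sigma> \<Longrightarrow> P (\<gamma> m \<sigma>)"
  shows "AE n in \<gamma>_push M N. P n"
proof -
  have s: "{n. \<not> P n} \<in> sets borel"
    using pred_intros_logic(2)[OF P] by (simp add: pred_def)
  have "(\<integral>\<^sup>+m. \<integral>\<^sup>+\<sigma>. indicator {n. \<not> P n} (\<gamma> m \<sigma>) \<partial>N \<partial>M) = (\<integral>\<^sup>+m. 0 \<partial>M)"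
  proof (rule nn_integral_cong_AE)
    show "AE m in M. (\<integral>\<^sup>+\<sigma>. indicator {n. \<not> P n} (\<gamma> m \<sigma>) \<partial>N) = 0"
      using AE(1)
    proof eventually_elim
      case (elim m)
      have "(\<integral>\<^sup>+\<sigma>. indicator {n. \<not> P n} (\<gamma> m \<sigma>) \<partial>N) = (\<integral>\<^sup>+\<sigma>. 0 \<partial>N)"
        using AE(2) by (intro nn_integral_cong_AE) (auto elim!: eventually_mono simp: QR[OF elim])
      then show ?case
        by simp
    qed
  qed
  then have "emeasure (\<gamma>_push M N) {n. \<not> P n} = 0"
    using nn_integral_\<gamma>_push[OF M, of "indicator {n. \<not> P n}"] s
    by (simp add: stateD(2)[OF state_\<gamma>_push[OF M]])
  then show ?thesis
    using s by (intro AE_I[where N = "{n. \<not> P n}"]) (auto simp: stateD(2)[OF state_\<gamma>_push[OF M]])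
qed

lemma parity_marginal_\<gamma>_push:
  assumes M: "state_on Xstar_even M" and N: "state_on S N"
  shows "distr (\<gamma>_push M N) borel parity = N"
proof -
  have sM: "state M" "AE m in M. m \<in> Xstar_even" and sN: "state N" "AE \<sigma> in N. \<sigma> \<in> S"
    using M N by (auto simp: state_on_def)
  interpret M: prob_space M by (rule stateD(1)[OF sM(1)])
  note st = state_\<gamma>_push[OF sM(1) sN(1)]
  show ?thesis
  proof (rule state_eqI[OF _ sN(1)])
    show "state (distr (\<gamma>_push M N) borel parity)"
      using measurable_parity
      by (intro state_distr stateD(1)[OF st]) (simp add: measurable_cong_sets[OF stateD(2)[OF st] refl])
    fix h :: "config \<Rightarrow> ennreal"
    assume h: "h \<in> borel_measurable borel"
    have "(\<integral>\<^sup>+n. h n \<partial>distr (\<gamma>_push M N) borel parity) = (\<integral>\<^sup>+n. h (parity n) \<partial>\<gamma>_push M N)"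
      by (rule nn_integral_distr_config[OF st measurable_parity h])
    also have "\<dots> = (\<integral>\<^sup>+m. \<integral>\<^sup>+\<sigma>. h (parity (\<gamma> m \<sigma>)) \<partial>N \<partial>M)"
      by (rule nn_integral_\<gamma>_push[OF sM(1) sN(1) measurable_compose[OF measurable_parity h]])
    also have "\<dots> = (\<integral>\<^sup>+m. \<integral>\<^sup>+\<sigma>. h \<sigma> \<partial>N \<partial>M)"
    proof (rule nn_integral_cong_AE)
      show "AE m in M. (\<integral>\<^sup>+\<sigma>. h (parity (\<gamma> m \<sigma>)) \<partial>N) = (\<integral>\<^sup>+\<sigma>. h \<sigma> \<partial>N)"
        using sM(2)
      proof eventually_elim
        case (elim m)
        show ?case
          using sN(2)
          by (intro nn_integral_cong_AE) (auto elim!: eventually_mono simp: \<gamma>_decompose(1)[OF elim])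
      qed
    qed
    also have "\<dots> = (\<integral>\<^sup>+\<sigma>. h \<sigma> \<partial>N)"
      by (simp add: M.emeasure_space_1)
    finally show "(\<integral>\<^sup>+n. h n \<partial>distr (\<gamma>_push M N) borel parity) = (\<integral>\<^sup>+\<sigma>. h \<sigma> \<partial>N)" .
  qed
qed

lemma state_parity:
  assumes "state M"
  shows "state_on S (distr M borel parity)"
  by (rule state_on_distr[OF assms measurable_parity measurable_S]) (simp add: parity_in_S)

lemma translation_invariant_parity:
  assumes "state M" "translation_invariant M"
  shows "translation_invariant (distr M borel parity)"
  by (rule translation_invariant_distr[OF assms measurable_parity translate_parity])

lemma measure_distr_config:
  assumes "state M" "f \<in> borel \<rightarrow>\<^sub>M borel" "A \<in> sets borel"
  shows "measure (distr M borel f) A = measure M (f -` A)"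
  using assms by (subst measure_distr) (simp_all add: stateD(3) measurable_cong_sets[OF stateD(2)[OF assms(1)] refl])

section \<open>Extremality and ergodicity of the parities\<close>

text \<open>A translation invariant parity event is also conserved by the dynamics. If its
  probability were strictly between 0 and 1, conditioning on it and on its complement would split
  \<open>M\<close> into two TIS states, against extremality.\<close>

lemma ETIS_parity_ergodic:
  assumes E: "ETIS M" and X: "AE n in M. n \<in> Xstar"
  shows "ergodic (distr M borel parity)"
  unfolding ergodic_def
proof (intro ballI impI)
  have T: "TIS M"
    using E by (simp add: ETIS_def)
  note M = TISD[OF T]
  interpret M: prob_space M by (rule stateD(1)[OF M(1)])
  fix A assume A: "A \<in> sets (borel :: config measure)" and inv: "\<forall>k. translate k -` A = A"
  define C where "C = parity -` A"
  have C: "C \<in> sets borel"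
    using measurable_sets[OF measurable_parity A] by (simp add: C_def)
  have cinv: "translate k n \<in> C \<longleftrightarrow> n \<in> C" for k n
    using inv by (auto simp: C_def simp flip: translate_parity)
  have TIS_cond: "TIS (uniform_measure M D)"
    if D: "D = C \<or> D = - C" and pos: "emeasure M D \<noteq> 0" for D
  proof -
    have sD: "D \<in> sets borel"
      using C D sets.compl_sets[OF C] by (auto simp: Compl_eq_Diff_UNIV)
    have "AE n in M. \<forall>c. ssm_step n c \<in> D \<longleftrightarrow> n \<in> D"
      using X by eventually_elim (use D in \<open>auto simp: C_def parity_step\<close>)
    moreover have "translate k -` D = D" for k
      using D cinv by auto
    ultimately show ?thesis
      using stationary_uniform[OF M(1,2) sD] translation_invariant_uniform[OF M(1,3) sD]
        state_uniform[OF M(1) pos]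
      by (simp add: TIS_def)
  qed
  show "measure (distr M borel parity) A = 0 \<or> measure (distr M borel parity) A = 1"
    unfolding measure_distr_config[OF M(1) measurable_parity A] C_def[symmetric]
  proof (rule ccontr)
    assume "\<not> (M.prob C = 0 \<or> M.prob C = 1)"
    then have t: "0 < M.prob C" "M.prob C < 1"
      using M.prob_le_1[of C] measure_nonneg[of M C] by linarith+
    have sets: "C \<in> M.events" "- C \<in> M.events"
      using C sets.compl_sets[OF C] by (auto simp: Compl_eq_Diff_UNIV stateD(2)[OF M(1)])
    have pc: "M.prob (- C) = 1 - M.prob C"
      using M.prob_compl[OF sets(1)] by (simp add: stateD(3)[OF M(1)] Compl_eq_Diff_UNIV)
    have pos: "emeasure M C \<noteq> 0" "emeasure M (- C) \<noteq> 0"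
      using t pc by (auto simp: M.emeasure_eq_measure)
    have "\<forall>B\<in>sets borel. M.prob B = M.prob C * measure (uniform_measure M C) B +
        (1 - M.prob C) * measure (uniform_measure M (- C)) B"
    proof
      fix B :: "config set" assume B: "B \<in> sets borel"
      have sB: "B \<in> M.events"
        using B by (simp add: stateD(2)[OF M(1)])
      have "M.prob B = M.prob (C \<inter> B) + M.prob (- C \<inter> B)"
        using sets sB by (subst M.finite_measure_Union[symmetric]) (auto intro: arg_cong[where f = M.prob])
      then show "M.prob B = M.prob C * measure (uniform_measure M C) B +
        (1 - M.prob C) * measure (uniform_measure M (- C)) B"
        using t pos sB M.emeasure_finite by (simp add: pc)
    qed
    then have "uniform_measure M C = M"
      using E TIS_cond[of C] TIS_cond[of "- C"] pos t unfolding ETIS_def by blast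
    moreover have "measure (uniform_measure M C) C = 1"
      using pos(1) sets(1) t M.emeasure_finite by simp
    ultimately show False
      using t by simp
  qed
qed

text \<open>The exceptional set of \<open>Q\<close> may fail to be measurable, so it is first
  enclosed in a Borel null set of \<open>M\<close>.\<close>

lemma AE_of_measure_zero:
  assumes "state M" "state N" and ac: "\<And>A. A \<in> sets borel \<Longrightarrow> measure M A = 0 \<Longrightarrow> measure N A = 0"
    and AE: "AE n in M. Q n"
  shows "AE n in N. Q n"
proof -
  interpret M: prob_space M by (rule stateD(1)[OF assms(1)])
  interpret N: prob_space N by (rule stateD(1)[OF assms(2)])
  obtain B where B: "{n \<in> space M. \<not> Q n} \<subseteq> B" "emeasure M B = 0" "B \<in> sets M"
    using AE_E[OF AE] by blast
  then have "measure N B = 0"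
    by (intro ac) (auto simp: stateD(2)[OF assms(1)] measure_def)
  then show ?thesis
    using B by (intro AE_I[where N = B]) (auto simp: stateD(2,3) assms(1,2) N.emeasure_eq_measure)
qed

section \<open>States built from the unique even state and an ergodic parity law\<close>

context
  fixes \<rho> \<kappa> :: real and \<mu> \<Lambda> :: "config measure"
  assumes \<mu>: "state_on Xstar_even \<mu>" "stationary \<mu>" "has_density \<mu> (\<rho> - \<kappa>)"
    and unique: "\<And>N. state_on Xstar_even N \<Longrightarrow> stationary N \<Longrightarrow> has_density N (\<rho> - \<kappa>) \<Longrightarrow> N = \<mu>"
    and \<Lambda>: "state_on S \<Lambda>" "translation_invariant \<Lambda>" "ergodic \<Lambda>" "has_density \<Lambda> \<kappa>"
begin

text \<open>Translates of \<open>\<mu>\<close> remain stationary, on \<open>Xstar_even\<close> and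
  of the same density, so uniqueness returns \<open>\<mu>\<close> itself.\<close>

lemma unique_translation_invariant: "translation_invariant \<mu>"
  unfolding translation_invariant_def
proof
  fix k
  have s: "state \<mu>" "AE n in \<mu>. n \<in> Xstar_even"
    using \<mu>(1) by (auto simp: state_on_def)
  show "distr \<mu> borel (translate k) = \<mu>"
  proof (rule unique)
    show "state_on Xstar_even (distr \<mu> borel (translate k))"
      using s(2) by (intro state_on_distr s(1) measurable_translate measurable_Xstar_even)
        (auto elim!: eventually_mono simp: translate_Xstar_even)
    show "stationary (distr \<mu> borel (translate k))"
      by (rule stationary_translate[OF s(1) \<mu>(2)])
    show "has_density (distr \<mu> borel (translate k)) (\<rho> - \<kappa>)"
      using \<mu>(3) unfolding has_density_iff[of \<mu>]
      by (intro has_density_distr s(1) measurable_translate) (auto elim!: eventually_mono simp: density_at_translate)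
  qed
qed

lemma product_TIS: "TIS (\<gamma>_push \<mu> \<Lambda>)" and product_density: "has_density (\<gamma>_push \<mu> \<Lambda>) \<rho>"
  and product_Xstar: "AE n in \<gamma>_push \<mu> \<Lambda>. n \<in> Xstar"
proof -
  have s: "state \<mu>" "AE n in \<mu>. n \<in> Xstar_even" "state \<Lambda>" "AE n in \<Lambda>. n \<in> S"
    using \<mu>(1) \<Lambda>(1) by (auto simp: state_on_def)
  show "TIS (\<gamma>_push \<mu> \<Lambda>)"
    unfolding TIS_def
    using state_\<gamma>_push[OF s(1,3)] translation_invariant_\<gamma>_push[OF s(1) unique_translation_invariant s(3) \<Lambda>(2)]
      stationary_\<gamma>_push[OF \<mu>(1,2) \<Lambda>(1)] by blast
  show "has_density (\<gamma>_push \<mu> \<Lambda>) \<rho>"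
    unfolding has_density_iff
    by (rule AE_\<gamma>_push[OF s(1,3) measurable_density_at \<mu>(3)[unfolded has_density_iff] \<Lambda>(4)[unfolded has_density_iff]])
      (use density_at_sum in fastforce)
  have "Measurable.pred borel (\<lambda>n. n \<in> Xstar)"
    unfolding Xstar_def by (simp, measurable)
  then show "AE n in \<gamma>_push \<mu> \<Lambda>. n \<in> Xstar"
    by (rule AE_\<gamma>_push[OF s(1,3) _ s(2,4)]) (rule \<gamma>_decompose(3))
qed

text \<open>A component of a convex decomposition is absolutely continuous with respect to the
  whole. It inherits the density and the restriction to \<open>Xstar\<close>, and its parity law,
  being absolutely continuous with respect to the ergodic \<Lambda>, equals \<Lambda>. Factorization
  then leaves a single possibility.\<close>

lemma product_ETIS: "ETIS (\<gamma>_push \<mu> \<Lambda>)"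
proof -
  let ?M = "\<gamma>_push \<mu> \<Lambda>"
  note M = TISD[OF product_TIS]
  have eq: "N = ?M"
    if N: "TIS N" and ac: "\<And>A. A \<in> sets borel \<Longrightarrow> measure ?M A = 0 \<Longrightarrow> measure N A = 0" for N
  proof -
    note N' = TISD[OF N]
    have marg: "distr ?M borel parity = \<Lambda>"
      by (rule parity_marginal_\<gamma>_push[OF \<mu>(1) \<Lambda>(1)])
    have p: "distr N borel parity = \<Lambda>"
    proof (rule ergodic_absolutely_continuous_eq)
      show "state \<Lambda>" "translation_invariant \<Lambda>" "ergodic \<Lambda>"
        using \<Lambda> by (auto simp: state_on_def)
      show "state (distr N borel parity)" "translation_invariant (distr N borel parity)"
        using state_parity[OF N'(1)] translation_invariant_parity[OF N'(1,3)] by (auto simp: state_on_def)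
      fix A assume A: "A \<in> sets (borel :: config measure)" and "measure \<Lambda> A = 0"
      then have "measure ?M (parity -` A) = 0"
        using measure_distr_config[OF M(1) measurable_parity A] marg by simp
      moreover have "parity -` A \<in> sets borel"
        using measurable_sets[OF measurable_parity A] by simp
      ultimately show "measure (distr N borel parity) A = 0"
        using ac measure_distr_config[OF N'(1) measurable_parity A] by simp
    qed
    have "N = \<gamma>_push \<mu> (distr N borel parity)"
    proof (rule stationary_state_factorizes[OF unique N'(1,2)])
      show "AE n in N. n \<in> Xstar"
        by (rule AE_of_measure_zero[OF M(1) N'(1) ac product_Xstar])
      show "has_density N \<rho>"
        unfolding has_density_iff
        by (rule AE_of_measure_zero[OF M(1) N'(1) ac product_density[unfolded has_density_iff]])
      show "has_density (distr N borel parity) \<kappa>"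
        unfolding p by (rule \<Lambda>(4))
    qed
    then show ?thesis
      unfolding p .
  qed
  show ?thesis
    unfolding ETIS_def
  proof (intro conjI product_TIS allI impI; elim conjE)
    fix M1 M2 t
    assume T: "TIS M1" "TIS M2" and t: "0 < t" "t < (1::real)"
      and mix: "\<forall>A\<in>sets borel. measure ?M A = t * measure M1 A + (1 - t) * measure M2 A"
    have "measure M1 A = 0" "measure M2 A = 0" if "A \<in> sets borel" "measure ?M A = 0" for A
    proof -
      have "t * measure M1 A + (1 - t) * measure M2 A = 0"
        using mix that by simp
      moreover have "0 \<le> t * measure M1 A" "0 \<le> (1 - t) * measure M2 A"
        using t by simp_all
      ultimately have "t * measure M1 A = 0" "(1 - t) * measure M2 A = 0"
        by linarith+
      then show "measure M1 A = 0" "measure M2 A = 0"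
        using t by simp_all
    qed
    then show "M1 = ?M" "M2 = ?M"
      using eq[OF T(1)] eq[OF T(2)] by blast+
  qed
qed

end

theorem theorem5p7:
  fixes \<rho> :: real
  assumes "\<forall>\<rho>e\<ge>1. \<forall>M.
      (state_on Xstar_even M \<and> stationary M \<and> has_density M \<rho>e) \<longleftrightarrow> M = \<mu>e \<rho>e"
    and "\<rho> > 1"
  shows "{M. ETIS M \<and> has_density M \<rho>} =
    {\<gamma>_push (\<mu>e \<rho>e) \<Lambda> | \<Lambda> \<kappa> \<rho>e.
       state_on S \<Lambda> \<and> translation_invariant \<Lambda> \<and> ergodic \<Lambda> \<and> has_density \<Lambda> \<kappa> \<and>
       \<kappa> \<le> \<rho> - 1 \<and> \<rho>e = \<rho> - \<kappa>}"
proof (intro equalityI subsetI)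
  fix M assume "M \<in> {M. ETIS M \<and> has_density M \<rho>}"
  then have E: "ETIS M" and d: "has_density M \<rho>"
    by auto
  have T: "TIS M"
    using E by (simp add: ETIS_def)
  note M = TISD[OF T]
  let ?\<Lambda> = "distr M borel parity"
  have X: "AE n in M. n \<in> Xstar"
    by (rule TIS_AE_Xstar[OF T d assms(2)])
  note \<Lambda> = state_parity[OF M(1)] translation_invariant_parity[OF M(1,3)] ETIS_parity_ergodic[OF E X]
  obtain \<kappa> where \<kappa>: "has_density ?\<Lambda> \<kappa>"
    using ergodic_has_density[OF \<Lambda>] by blast
  have le: "\<kappa> \<le> \<rho> - 1"
    by (rule density_bound[OF M(1) X d \<kappa>])
  \<comment> \<open>The bound on \<kappa> places \<open>\<rho> - \<kappa>\<close> in the range of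
    densities covered by the hypothesis.\<close>
  have "(state_on Xstar_even N \<and> stationary N \<and> has_density N (\<rho> - \<kappa>)) \<longleftrightarrow> N = \<mu>e (\<rho> - \<kappa>)" for N
    using assms(1) le by simp
  then have "M = \<gamma>_push (\<mu>e (\<rho> - \<kappa>)) ?\<Lambda>"
    by (intro stationary_state_factorizes[OF _ M(1,2) X d \<kappa>]) blast
  then show "M \<in> {\<gamma>_push (\<mu>e \<rho>e) \<Lambda> | \<Lambda> \<kappa> \<rho>e.
       state_on S \<Lambda> \<and> translation_invariant \<Lambda> \<and> ergodic \<Lambda> \<and> has_density \<Lambda> \<kappa> \<and>
       \<kappa> \<le> \<rho> - 1 \<and> \<rho>e = \<rho> - \<kappa>}"
    using \<Lambda> \<kappa> le by blast
next
  fix M assume "M \<in> {\<gamma>_push (\<mu>e \<rho>e) \<Lambda> | \<Lambda> \<kappa> \<rho>e.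
       state_on S \<Lambda> \<and> translation_invariant \<Lambda> \<and> ergodic \<Lambda> \<and> has_density \<Lambda> \<kappa> \<and>
       \<kappa> \<le> \<rho> - 1 \<and> \<rho>e = \<rho> - \<kappa>}"
  then obtain \<Lambda> \<kappa> where M: "M = \<gamma>_push (\<mu>e (\<rho> - \<kappa>)) \<Lambda>"
    and \<Lambda>: "state_on S \<Lambda>" "translation_invariant \<Lambda>" "ergodic \<Lambda>" "has_density \<Lambda> \<kappa>" and le: "\<kappa> \<le> \<rho> - 1"
    by auto
  have iff: "(state_on Xstar_even N \<and> stationary N \<and> has_density N (\<rho> - \<kappa>)) \<longleftrightarrow> N = \<mu>e (\<rho> - \<kappa>)" for N
    using assms(1) le by simp
  then have \<mu>: "state_on Xstar_even (\<mu>e (\<rho> - \<kappa>))" "stationary (\<mu>e (\<rho> - \<kappa>))"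
    "has_density (\<mu>e (\<rho> - \<kappa>)) (\<rho> - \<kappa>)"
    by blast+
  have unique: "\<And>N. state_on Xstar_even N \<Longrightarrow> stationary N \<Longrightarrow> has_density N (\<rho> - \<kappa>) \<Longrightarrow> N = \<mu>e (\<rho> - \<kappa>)"
    using iff by blast
  show "M \<in> {M. ETIS M \<and> has_density M \<rho>}"
    unfolding M using product_ETIS[OF \<mu> unique \<Lambda>] product_density[OF \<mu> unique \<Lambda>] by blast
qed

end
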